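(* Let $G$ be a graph without isolated vertices. For $p_n<c<1$, $n\ge1$, we have $$d_K\big(\widetilde N^G_n,\mathcal N\big)\lesssim\left(\min_{\substack{H\subset G\\ e_H\ge1}}\big\{n^{v_H}p_n^{e_H}\big\}\right)^{-1/2}.$$ On the other hand, for $p_n>c>0$, $n\ge1$, it holds that $$d_K\big(\widetilde N^G_n,\mathcal N\big)\lesssim\frac{1}{n\sqrt{1-p_n}}.$$
   Context: For positive functions $f,g$, the notation $f\lesssim g$ means that $f\le C_G\,g$ for some constant $C_G>0$ depending only on $G$. For a graph $H$, $v_H$ and $e_H$ denote its numbers of vertices and edges; $H\subset G$ means that $H$ is a subgraph of $G$. $\mathbb G_n(p_n)$ is the Erdős–Rényi random graph obtained by independently retaining each edge of the complete graph $K_n$ on $n$ vertices with probability $p_n\in(0,1)$. $N^G_n$ is the number of (not necessarily induced) subgraphs of $\mathbb G_n(p_n)$ isomorphic to $G$, and $$\widetilde N^G_n=\frac{N^G_n-\mathbb E[N^G_n]}{\sqrt{\mathrm{Var}[N^G_n]}}.$$ $d_K(F,\mathcal N)=\sup_{x\in\mathbb R}|P(F\le x)-P(\mathcal N\le x)|$ is the Kolmogorov distance, where $\mathcal N$ is a standard normal random variable.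
   Formalization: The implied constant in each bound is allowed to depend on the fixed number c as well as on G; with a constant depending on G alone, uniformly in c, both bounds fail already for G a single edge (p near 1 in the first, p = n^(-2) in the second). *)

theory Defs
  imports "HOL-Probability.Probability"
begin

datatype 'a ugraph = UGraph (verts: "'a set") (edges: "'a set set")

definition simple_graph :: "'a ugraph \<Rightarrow> bool" where
  "simple_graph G \<longleftrightarrow> finite (verts G) \<and> (\<forall>e\<in>edges G. e \<subseteq> verts G \<and> card e = 2)"

definition no_isolated_vertices :: "'a ugraph \<Rightarrow> bool" where
  "no_isolated_vertices G \<longleftrightarrow> (\<forall>v\<in>verts G. \<exists>e\<in>edges G. v \<in> e)"

text \<open>Not necessarily induced, and not necessarily proper.\<close>

definition subgraph :: "'a ugraph \<Rightarrow> 'a ugraph \<Rightarrow> bool" where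
  "subgraph H G \<longleftrightarrow> simple_graph H \<and> verts H \<subseteq> verts G \<and> edges H \<subseteq> edges G"

definition graph_iso :: "'a ugraph \<Rightarrow> 'b ugraph \<Rightarrow> bool" where
  "graph_iso G H \<longleftrightarrow>
     (\<exists>f. bij_betw f (verts G) (verts H) \<and>
          (\<forall>u\<in>verts G. \<forall>v\<in>verts G. {u, v} \<in> edges G \<longleftrightarrow> {f u, f v} \<in> edges H))"

definition complete_graph :: "nat \<Rightarrow> nat ugraph" where
  "complete_graph n = UGraph {..<n} {e. e \<subseteq> {..<n} \<and> card e = 2}"

definition random_graph :: "nat \<Rightarrow> real \<Rightarrow> nat ugraph pmf" where
  "random_graph n p =
     map_pmf (\<lambda>\<omega>. UGraph (verts (complete_graph n)) {e \<in> edges (complete_graph n). \<omega> e})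
       (Pi_pmf (edges (complete_graph n)) False (\<lambda>_. bernoulli_pmf p))"

definition subgraph_count :: "'a ugraph \<Rightarrow> 'b ugraph \<Rightarrow> nat" where
  "subgraph_count G K = card {H. subgraph H K \<and> graph_iso H G}"

text \<open>
  If \<open>n < card (verts G)\<close>, the count is constantly 0 and its variance vanishes;
  since \<open>x / 0 = 0\<close>, the normalized count is then constantly 0.
\<close>

definition normalized_count :: "'a ugraph \<Rightarrow> nat \<Rightarrow> real \<Rightarrow> nat ugraph \<Rightarrow> real" where
  "normalized_count G n p K =
     (real (subgraph_count G K)
        - measure_pmf.expectation (random_graph n p) (\<lambda>K. real (subgraph_count G K)))
     / sqrt (measure_pmf.variance (random_graph n p) (\<lambda>K. real (subgraph_count G K)))"

text \<open>The Kolmogorov distance of two random variables, as a function of their distributions.\<close>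

definition kolmogorov_dist :: "real measure \<Rightarrow> real measure \<Rightarrow> real" where
  "kolmogorov_dist M N = (SUP x. \<bar>cdf M x - cdf N x\<bar>)"

definition normalized_count_distr :: "'a ugraph \<Rightarrow> nat \<Rightarrow> real \<Rightarrow> real measure" where
  "normalized_count_distr G n p =
     distr (measure_pmf (random_graph n p)) borel (normalized_count G n p)"

definition min_subgraph_weight :: "'a ugraph \<Rightarrow> nat \<Rightarrow> real \<Rightarrow> real" where
  "min_subgraph_weight G n p =
     Min {real n ^ card (verts H) * p ^ card (edges H) | H. subgraph H G \<and> card (edges H) \<ge> 1}"

end

theory Submission
  imports Defs "HOL-Real_Asymp.Real_Asymp"
begin

text \<open>
  Write \<open>q = 1 - p\<close> and let \<open>\<Psi>\<close> be the minimal subgraph weight. Both estimates follow from the single bound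
  \<open>d_K \<le> C (q \<Psi>)^(-1/2)\<close>, since \<open>q \<ge> 1 - c\<close> in the first regime and \<open>\<Psi> \<ge> c^e n^2\<close> in the second.

  The count is a sum of monomials in independent Bernoulli variables. Replacing the factors of a
  monomial by their means one edge at a time writes the centred count as \<open>\<Sum>k. (X_k - p) V_k\<close>
  with \<open>V_k \<ge> 0\<close> not depending on \<open>X_k\<close>. Together with discrete integration by parts this turns
  Stein's equation for indicators into a Kolmogorov bound: the remainder of the first-order expansion
  of the Stein solution is dominated by increments of monotone functions, to which integration by
  parts applies once more, so only second moments of sums of monomials have to be estimated. These are sums
  over connected quadruples of copies of \<open>G\<close>. Adding the copies one by one, each of the three new ones
  shares an edge with the previous ones and contributes a factor \<open>n^v p^e / \<Psi>\<close>, while the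
  variance is at least of order \<open>q (n^v p^e)^2 / \<Psi>\<close> because of pairs of copies sharing a minimizing subgraph.
\<close>

section \<open>The Stein equation for the Kolmogorov distance\<close>

text \<open>The obstacle is the jump of the indicator: the derivative of the Stein solution is
  discontinuous at the threshold, so a Taylor remainder would call for an estimate of the
  probability that the normalized count W is close to it. Monotonicity removes this difficulty.
  Adding an edge can only increase the count, so W lies between its values with edge k absent and
  present, and the linearization error is at most the step length times the increment of a
  nondecreasing function of W that is bounded by 2. The coefficient of this increment is nonnegative
  and free of X_k, so the accumulated error is again of the form produced by integration by parts.
  Undoing that integration leaves a centred sum, whose second moment is small by cancellation. This
  is why the count is telescoped edge by edge: an orthogonal decomposition into products of centred
  variables would have coefficients V_k of both signs. The factor q has to survive as well: one q in
  the second-moment bound, set against one q in the variance, gives the power q^(-1/2) that appears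
  as 1/sqrt(1 - p) when p is bounded below.\<close>

definition Phi :: "real \<Rightarrow> real" where
  "Phi = cdf std_normal_distribution"

interpretation std_normal: real_distribution std_normal_distribution
  by (rule real_dist_normal_dist)

lemma Phi_diff:
  assumes "a \<le> x"
  shows "Phi x - Phi a = integral {a..x} std_normal_density"
proof (cases "a = x")
  case False
  with assms have "a < x" by simp
  have int: "integrable lborel std_normal_density"
    by simp
  have "Phi x - Phi a = measure std_normal_distribution {a<..x}"
    unfolding Phi_def using std_normal.cdf_diff_eq[OF \<open>a < x\<close>] by simp
  also have "\<dots> = (LINT t|std_normal_distribution. indicator {a<..x} t)"
    by (simp add: Bochner_Integration.integral_indicator)
  also have "\<dots> = (LINT t|lborel. indicator {a<..x} t * std_normal_density t)"
    by (subst integral_density) (auto simp: mult.commute)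
  also have "\<dots> = (LINT t : {a<..x}|lborel. std_normal_density t)"
    by (simp add: set_lebesgue_integral_def)
  also have "\<dots> = integral {a<..x} std_normal_density"
    by (rule set_borel_integral_eq_integral) (use integrable_mult_indicator[OF _ int, of "{a<..x}"] in \<open>simp add: set_integrable_def\<close>)
  also have "\<dots> = integral {a..x} std_normal_density"
    by (rule integral_spike_set) (rule negligible_subset[of "{a}"], auto)+
  finally show ?thesis .
qed simp

lemma continuous_on_std_normal_density: "continuous_on S std_normal_density"
  unfolding std_normal_density_def by (intro continuous_intros) auto

lemma DERIV_Phi: "(Phi has_real_derivative std_normal_density x) (at x)"
proof -
  have "((\<lambda>t. integral {x-1..t} std_normal_density) has_real_derivative std_normal_density x)
          (at x within {x-1..x+1})"
    by (rule integral_has_real_derivative) (auto intro: continuous_on_std_normal_density)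
  hence "((\<lambda>t. integral {x-1..t} std_normal_density) has_real_derivative std_normal_density x) (at x)"
    by (subst (asm) at_within_interior) (auto simp: interior_cbox)
  hence "((\<lambda>t. Phi (x-1) + integral {x-1..t} std_normal_density) has_real_derivative std_normal_density x) (at x)"
    by (auto intro!: derivative_eq_intros)
  thus ?thesis
  proof (rule DERIV_cong_ev[THEN iffD1, rotated -1, OF _ refl])
    show "\<forall>\<^sub>F t in nhds x. Phi (x-1) + integral {x-1..t} std_normal_density = Phi t"
      using eventually_nhds_in_open[of "{x-1<..}" x]
      by (auto elim!: eventually_mono simp: Phi_diff[symmetric])
  qed auto
qed

lemma DERIV_std_normal_density:
  "(std_normal_density has_real_derivative - x * std_normal_density x) (at x)"
  unfolding std_normal_density_def[abs_def]
  by (auto intro!: derivative_eq_intros simp: field_simps)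

lemma Phi_nonneg: "0 \<le> Phi x" and Phi_le_1: "Phi x \<le> 1"
  by (auto simp: Phi_def std_normal.cdf_nonneg std_normal.cdf_bounded_prob)

text \<open>The density is even, so the sum of both values has derivative zero; the constant is read
  off at infinity.\<close>

lemma Phi_minus: "Phi (- x) = 1 - Phi x"
proof -
  let ?h = "\<lambda>x. Phi x + Phi (- x)"
  have "\<exists>c. \<forall>x\<in>UNIV. ?h x = c"
  proof (rule has_field_derivative_zero_constant)
    fix x
    have "((\<lambda>x. Phi (- x)) has_real_derivative std_normal_density (- x) * (- 1)) (at x)"
      by (rule DERIV_chain2[OF DERIV_Phi]) (auto intro!: derivative_eq_intros)
    from DERIV_add[OF DERIV_Phi this] show "(?h has_real_derivative 0) (at x)"
      by (simp add: std_normal_density_def)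
  qed auto
  then obtain c where c: "\<And>x. ?h x = c" by auto
  have top: "(Phi \<longlongrightarrow> 1) at_top"
    unfolding Phi_def by (rule std_normal.cdf_lim_at_top_prob)
  have bot: "(Phi \<longlongrightarrow> 0) at_bot"
    unfolding Phi_def by (rule std_normal.cdf_lim_at_bot)
  have "((\<lambda>x. Phi (- x)) \<longlongrightarrow> 0) at_top"
    using bot by (simp add: filterlim_at_bot_mirror)
  from tendsto_add[OF top this] have "(?h \<longlongrightarrow> 1) at_top" by simp
  hence "c = 1" unfolding c by (simp add: tendsto_const_iff)
  with c[of x] show ?thesis by simp
qed

section \<open>Gaussian tail inequalities\<close>

lemma nonneg_if_DERIV_nonneg_at_bot:
  fixes f f' :: "real \<Rightarrow> real"
  assumes "\<And>x. (f has_real_derivative f' x) (at x)" "\<And>x. 0 \<le> f' x" "(f \<longlongrightarrow> 0) at_bot"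
  shows "0 \<le> f x"
proof (rule tendsto_upperbound[OF assms(3)])
  show "\<forall>\<^sub>F y in at_bot. f y \<le> f x"
    using eventually_le_at_bot[of x]
  proof eventually_elim
    case (elim y)
    show ?case by (rule DERIV_nonneg_imp_nondecreasing[OF elim]) (use assms in blast)
  qed
qed auto

text \<open>A crude bound, from \<open>(x + 1)\<^sup>2 \<ge> 0\<close> in the exponent of the
  density. It only has to make \<open>Phi\<close> beat polynomials at minus infinity, which supplies
  the boundary values for the two inequalities below.\<close>

lemma Phi_le_exp: "Phi x \<le> exp (x + 1/2)"
proof -
  have "0 \<le> exp (x + 1/2) - Phi x"
  proof (rule nonneg_if_DERIV_nonneg_at_bot[where f = "\<lambda>x. exp (x + 1/2) - Phi x"])
    show "((\<lambda>x. exp (x + 1/2) - Phi x) has_real_derivative exp (x + 1/2) - std_normal_density x) (at x)" for x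
      by (auto intro!: derivative_eq_intros DERIV_Phi)
    show "0 \<le> exp (x + 1/2) - std_normal_density x" for x :: real
    proof -
      have "std_normal_density x \<le> 1 * exp (- x\<^sup>2 / 2)"
        unfolding std_normal_density_def using pi_ge_two
        by (intro mult_right_mono) (auto simp: field_simps)
      also have "- x\<^sup>2 / 2 \<le> x + 1/2"
        using zero_le_power2[of "x + 1"] by (simp add: power2_eq_square field_simps)
      finally show ?thesis by simp
    qed
    have "((\<lambda>x::real. exp (x + 1/2)) \<longlongrightarrow> 0) at_bot"
      by real_asymp
    moreover have "(Phi \<longlongrightarrow> 0) at_bot"
      unfolding Phi_def by (rule std_normal.cdf_lim_at_bot)
    ultimately show "((\<lambda>x. exp (x + 1/2) - Phi x) \<longlongrightarrow> 0) at_bot"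
      using tendsto_diff by fastforce
  qed
  thus ?thesis by simp
qed

lemma Phi_tail_1: "((\<lambda>x. x * Phi x) \<longlongrightarrow> 0) at_bot"
proof (rule Lim_null_comparison)
  show "\<forall>\<^sub>F x in at_bot. norm (x * Phi x) \<le> \<bar>x\<bar> * exp (x + 1/2)"
    by (rule always_eventually) (auto simp: abs_mult Phi_nonneg Phi_le_exp intro!: mult_left_mono)
  show "((\<lambda>x::real. \<bar>x\<bar> * exp (x + 1/2)) \<longlongrightarrow> 0) at_bot"
    by real_asymp
qed

lemma Phi_tail_2: "((\<lambda>x. (1 + x\<^sup>2) * Phi x) \<longlongrightarrow> 0) at_bot"
proof (rule Lim_null_comparison)
  show "\<forall>\<^sub>F x in at_bot. norm ((1 + x\<^sup>2) * Phi x) \<le> (1 + x\<^sup>2) * exp (x + 1/2)"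
    by (rule always_eventually) (auto simp: abs_mult Phi_nonneg Phi_le_exp intro!: mult_left_mono)
  show "((\<lambda>x::real. (1 + x\<^sup>2) * exp (x + 1/2)) \<longlongrightarrow> 0) at_bot"
    by real_asymp
qed

lemma Mills_upper: "0 \<le> x * Phi x + std_normal_density x"
proof (rule nonneg_if_DERIV_nonneg_at_bot[where f = "\<lambda>x. x * Phi x + std_normal_density x"])
  show "((\<lambda>x. x * Phi x + std_normal_density x) has_real_derivative Phi x) (at x)" for x
    by (auto intro!: derivative_eq_intros DERIV_Phi DERIV_std_normal_density)
  have "(std_normal_density \<longlongrightarrow> 0) at_bot"
    unfolding std_normal_density_def[abs_def] by real_asymp
  from tendsto_add[OF Phi_tail_1 this]
  show "((\<lambda>x. x * Phi x + std_normal_density x) \<longlongrightarrow> 0) at_bot" by simp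
qed (rule Phi_nonneg)

text \<open>The derivative is twice the expression in \<open>Mills_upper\<close>, so this inequality
  is the previous one integrated from minus infinity. For negative x the two are the classical
  estimates of the tail by density/|x| from above and |x| density/(1 + x^2) from below.\<close>

lemma Mills_lower: "0 \<le> (1 + x\<^sup>2) * Phi x + x * std_normal_density x"
proof (rule nonneg_if_DERIV_nonneg_at_bot[where f = "\<lambda>x. (1 + x\<^sup>2) * Phi x + x * std_normal_density x"])
  show "((\<lambda>x. (1 + x\<^sup>2) * Phi x + x * std_normal_density x) has_real_derivative
          2 * (x * Phi x + std_normal_density x)) (at x)" for x
    by (auto intro!: derivative_eq_intros DERIV_Phi DERIV_std_normal_density
             simp: algebra_simps power2_eq_square)
  have "((\<lambda>x. x * std_normal_density x) \<longlongrightarrow> 0) at_bot"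
    unfolding std_normal_density_def[abs_def] by real_asymp
  from tendsto_add[OF Phi_tail_2 this]
  show "((\<lambda>x. (1 + x\<^sup>2) * Phi x + x * std_normal_density x) \<longlongrightarrow> 0) at_bot" by simp
qed (simp only: mult_nonneg_nonneg Mills_upper zero_le_numeral)

section \<open>The Mills ratio and the solution of Stein's equation\<close>

definition Mills :: "real \<Rightarrow> real" where
  "Mills w = Phi w / std_normal_density w"

text \<open>The bounded solution of f'(w) - w f(w) = 1(w \<le> z) - Phi z. Each branch solves the
  equation on its side of z; \<open>Mills (- w)\<close> is the usual Mills ratio of the right
  tail.\<close>

definition Stein_sol :: "real \<Rightarrow> real \<Rightarrow> real" where
  "Stein_sol z w = (if w \<le> z then (1 - Phi z) * Mills w else Phi z * Mills (- w))"

lemma std_normal_density_minus: "std_normal_density (- x) = std_normal_density x"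
  by (simp add: std_normal_density_def)

lemma std_normal_density_pos [simp]: "0 < std_normal_density x"
  by (rule normal_density_pos) simp

lemma mult_Mills_ge: "- 1 \<le> w * Mills w"
  using Mills_upper[of w] std_normal_density_pos[of w] by (simp add: Mills_def field_simps)

lemma DERIV_Mills: "(Mills has_real_derivative 1 + w * Mills w) (at w)"
  unfolding Mills_def[abs_def]
proof -
  have "std_normal_density w \<noteq> 0"
    using std_normal_density_pos[of w] by linarith
  from DERIV_divide[OF DERIV_Phi DERIV_std_normal_density this]
  show "((\<lambda>w. Phi w / std_normal_density w) has_real_derivative
      1 + w * (Phi w / std_normal_density w)) (at w)"
    by (rule DERIV_cong) (use \<open>std_normal_density w \<noteq> 0\<close> in \<open>simp add: field_simps\<close>)
qed

lemma mult_Mills_mono: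
  assumes "v \<le> w" shows "v * Mills v \<le> w * Mills w"
proof (rule DERIV_nonneg_imp_nondecreasing[OF assms])
  fix x
  have "((\<lambda>x. x * Mills x) has_real_derivative Mills x + x * (1 + x * Mills x)) (at x)"
    by (auto intro!: derivative_eq_intros DERIV_Mills)
  \<comment> \<open>The numerator is the expression shown nonnegative in
    \<open>Mills_lower\<close>.\<close>
  moreover have "Mills x + x * (1 + x * Mills x) = ((1 + x\<^sup>2) * Phi x + x * std_normal_density x) / std_normal_density x"
    by (simp add: Mills_def add_divide_distrib algebra_simps power2_eq_square less_imp_neq[OF std_normal_density_pos, symmetric])
  moreover have "\<dots> \<ge> 0"
    using Mills_lower[of x] by simp
  ultimately show "\<exists>y. ((\<lambda>x. x * Mills x) has_real_derivative y) (at x) \<and> 0 \<le> y"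
    by metis
qed

text \<open>The two branches of \<open>Stein_sol\<close> agree at z. Hence the solution is
  continuous, and the right-hand formula may be used at z too.\<close>

lemma Mills_symmetric: "(1 - Phi z) * Mills z = Phi z * Mills (- z)"
  by (simp add: Mills_def Phi_minus std_normal_density_minus)

lemma Stein_sol_at_ge: "z \<le> w \<Longrightarrow> Stein_sol z w = Phi z * Mills (- w)"
  using Mills_symmetric[of z] by (cases "w = z") (auto simp: Stein_sol_def)

text \<open>On either side of z this is \<open>mult_Mills_mono\<close>, reflected on the right, and
  the sides are glued at z. It makes the derivative of the Stein solution a monotone function plus
  an indicator.\<close>

lemma Stein_sol_mult_mono:
  assumes "v \<le> w" shows "v * Stein_sol z v \<le> w * Stein_sol z w"
proof -
  have A: "v * Stein_sol z v \<le> w * Stein_sol z w" if "v \<le> w" "w \<le> z" for v w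
    using mult_left_mono[OF mult_Mills_mono[OF that(1)], of "1 - Phi z"] that Phi_le_1[of z]
    by (simp add: Stein_sol_def mult_ac)
  have B: "v * Stein_sol z v \<le> w * Stein_sol z w" if "v \<le> w" "z \<le> v" for v w
    using mult_left_mono[OF mult_Mills_mono[of "-w" "-v"], of "Phi z"] that Phi_nonneg[of z]
    by (simp add: Stein_sol_at_ge mult_ac)
  show ?thesis
    using A[of v w] B[of v w] A[of v z] B[of z w] assms by linarith
qed

text \<open>Only the left branch is estimated. Its upper bound moves w up to z, exchanges the
  branches there and uses \<open>mult_Mills_ge\<close> at - z. Reflecting both w and z turns the
  right branch into the left one and swaps the two bounds.\<close>

lemma Stein_sol_mult_bounds:
  "Phi z - 1 \<le> w * Stein_sol z w" "w * Stein_sol z w \<le> Phi z"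
proof -
  have *: "(1 - Phi z) * (w * Mills w) \<le> Phi z" if "w \<le> z" for w z
  proof -
    have "(1 - Phi z) * (w * Mills w) \<le> (1 - Phi z) * (z * Mills z)"
      using that Phi_le_1[of z] by (intro mult_left_mono mult_Mills_mono) auto
    also have "\<dots> = z * (Phi z * Mills (- z))"
      using Mills_symmetric[of z] by simp
    also have "\<dots> = Phi z * (- ((-z) * Mills (-z)))" by simp
    also have "\<dots> \<le> Phi z * 1"
      using mult_Mills_ge[of "-z"] Phi_nonneg[of z] by (intro mult_left_mono) auto
    finally show ?thesis by simp
  qed
  have lo: "- (1 - Phi z) \<le> (1 - Phi z) * (w * Mills w)" for w z
    using mult_left_mono[OF mult_Mills_ge[of w], of "1 - Phi z"] Phi_le_1[of z] by simp
  show "Phi z - 1 \<le> w * Stein_sol z w" "w * Stein_sol z w \<le> Phi z"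
    using *[of w z] *[of "-w" "-z"] lo[of z w] lo[of "-z" "-w"]
    by (auto simp: Stein_sol_def Phi_minus mult_ac)
qed

text \<open>Stein's equation read as a definition, so that it holds at every point. At the kink w =
  z the value is the left derivative.\<close>

definition Stein_deriv :: "real \<Rightarrow> real \<Rightarrow> real" where
  "Stein_deriv z w = w * Stein_sol z w + of_bool (w \<le> z) - Phi z"

lemma abs_Stein_deriv_le_1: "\<bar>Stein_deriv z w\<bar> \<le> 1"
proof -
  have "Stein_deriv z w \<le> 1" if "w \<le> z"
    using Stein_sol_mult_bounds(2)[where z = z and w = w] that by (auto simp: Stein_deriv_def)
  thus ?thesis
    using Stein_sol_mult_bounds[where z = z and w = w] Phi_nonneg[of z] Phi_le_1[of z]
    by (auto simp: Stein_deriv_def)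
qed

lemma continuous_on_Stein_sol: "continuous_on S (Stein_sol z)"
proof -
  have cM: "continuous_on T Mills" for T
    by (rule DERIV_continuous_on[OF has_field_derivative_at_within[OF DERIV_Mills]])
  have "continuous_on {..z} (Stein_sol z)"
    by (rule continuous_on_eq[of _ "\<lambda>w. (1 - Phi z) * Mills w"])
       (auto intro!: continuous_intros cM simp: Stein_sol_def)
  moreover have "continuous_on {z..} (Stein_sol z)"
    by (rule continuous_on_eq[of _ "\<lambda>w. Phi z * Mills (- w)"])
       (auto intro!: continuous_intros continuous_on_compose2[OF cM[of UNIV]] simp: Stein_sol_at_ge)
  ultimately have "continuous_on ({..z} \<union> {z..}) (Stein_sol z)"
    by (intro continuous_on_closed_Un) auto
  moreover have "{..z} \<union> {z..} = UNIV" by auto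
  ultimately have "continuous_on UNIV (Stein_sol z)" by simp
  thus ?thesis using continuous_on_subset by blast
qed

lemma DERIV_Stein_sol:
  assumes "w \<noteq> z"
  shows "(Stein_sol z has_real_derivative Stein_deriv z w) (at w)"
proof (cases "w < z")
  case True
  have "((\<lambda>w. (1 - Phi z) * Mills w) has_real_derivative (1 - Phi z) * (1 + w * Mills w)) (at w)"
    by (intro DERIV_cmult DERIV_Mills)
  moreover have "(1 - Phi z) * (1 + w * Mills w) = Stein_deriv z w"
    using True by (simp add: Stein_deriv_def Stein_sol_def algebra_simps)
  ultimately have "((\<lambda>w. (1 - Phi z) * Mills w) has_real_derivative Stein_deriv z w) (at w)" by simp
  thus ?thesis
    by (rule has_field_derivative_transform_within_open[of _ _ _ "{..<z}"])
       (use True in \<open>auto simp: Stein_sol_def\<close>)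
next
  case False
  with assms have w: "w > z" by simp
  have "((\<lambda>w. Mills (- w)) has_real_derivative (1 + (-w) * Mills (-w)) * (- 1)) (at w)"
    by (rule DERIV_chain2[OF DERIV_Mills]) (auto intro!: derivative_eq_intros)
  hence "((\<lambda>w. Phi z * Mills (-w)) has_real_derivative Phi z * ((1 + (-w) * Mills (-w)) * (- 1))) (at w)"
    by (intro DERIV_cmult)
  moreover have "Phi z * ((1 + (-w) * Mills (-w)) * (- 1)) = Stein_deriv z w"
    using w by (simp add: Stein_deriv_def Stein_sol_def algebra_simps)
  ultimately have "((\<lambda>w. Phi z * Mills (-w)) has_real_derivative Stein_deriv z w) (at w)" by simp
  thus ?thesis
    by (rule has_field_derivative_transform_within_open[of _ _ _ "{z<..}"])
       (use w in \<open>auto simp: Stein_sol_def\<close>)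
qed

text \<open>
  The bound is an increment of a function of the endpoints alone; this is what allows a second
  integration by parts in place of a third-moment estimate.
\<close>

lemma Stein_sol_increment:
  assumes "a \<le> w" "w \<le> b"
  shows "\<bar>Stein_sol z b - Stein_sol z a - (b - a) * Stein_deriv z w\<bar> \<le>
    (b - a) * (b * Stein_sol z b - of_bool (b \<le> z) - (a * Stein_sol z a - of_bool (a \<le> z)))"
    (is "_ \<le> _ * ?K")
proof -
  \<comment> \<open>\<open>Stein_deriv\<close> is a nondecreasing part plus the nonincreasing
    indicator. Its oscillation on [a, b] is at most the sum of the total variations of the two
    parts, which is \<open>?K\<close>.\<close>
  have osc: "\<bar>Stein_deriv z x - Stein_deriv z w\<bar> \<le> ?K" if "a \<le> x" "x \<le> b" for x
    using Stein_sol_mult_mono[of x w z] Stein_sol_mult_mono[of w x z] assms that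
      Stein_sol_mult_mono[of a x z] Stein_sol_mult_mono[of a w z] Stein_sol_mult_mono[of w b z]
      Stein_sol_mult_mono[of x b z]
    by (auto simp: Stein_deriv_def of_bool_def split: if_splits)
  \<comment> \<open>The mean value theorem needs differentiability inside the interval, so z may not
    be an interior point. Keeping the base point w fixed lets the estimates to the left and to the
    right of z be added.\<close>
  have piece: "\<bar>Stein_sol z y - Stein_sol z x - (y - x) * Stein_deriv z w\<bar> \<le> (y - x) * ?K"
    if xy: "a \<le> x" "x \<le> y" "y \<le> b" "\<not> (x < z \<and> z < y)" for x y
  proof (cases "x = y")
    case False
    with xy have "x < y" by simp
    have D: "(Stein_sol z has_real_derivative Stein_deriv z t) (at t)" if "x < t" "t < y" for t
      using that xy(4) by (intro DERIV_Stein_sol) auto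
    obtain l \<xi> where \<xi>: "x < \<xi>" "\<xi> < y" "(Stein_sol z has_real_derivative l) (at \<xi>)"
      "Stein_sol z y - Stein_sol z x = (y - x) * l"
      using MVT[OF \<open>x < y\<close> continuous_on_Stein_sol, of z] D real_differentiable_def by metis
    with DERIV_unique[OF D[of \<xi>]] have l: "l = Stein_deriv z \<xi>" by simp
    have "\<bar>(y - x) * (Stein_deriv z \<xi> - Stein_deriv z w)\<bar> \<le> (y - x) * ?K"
      proof -
      have "\<bar>Stein_deriv z \<xi> - Stein_deriv z w\<bar> \<le> ?K"
        by (rule osc) (use xy \<xi> in auto)
      from mult_left_mono[OF this, of "y - x"] show ?thesis
        using \<open>x < y\<close> by (simp add: abs_mult)
    qed
    thus ?thesis using \<xi>(4) l by (simp add: algebra_simps)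
  qed simp
  show ?thesis
  proof (cases "a < z \<and> z < b")
    case True
    have "\<bar>Stein_sol z b - Stein_sol z a - (b - a) * Stein_deriv z w\<bar> \<le>
      \<bar>Stein_sol z z - Stein_sol z a - (z - a) * Stein_deriv z w\<bar> +
      \<bar>Stein_sol z b - Stein_sol z z - (b - z) * Stein_deriv z w\<bar>"
      by (simp add: algebra_simps)
    also have "\<dots> \<le> (z - a) * ?K + (b - z) * ?K"
      using True by (intro add_mono piece) auto
    also have "\<dots> = (b - a) * ?K" by (simp add: algebra_simps)
    finally show ?thesis .
  qed (use assms piece[of a b] in auto)
qed

section \<open>Stein's method on a Bernoulli product space\<close>

locale bernoulli_field =
  fixes E :: "'e set" and p :: real
  assumes finite_E: "finite E" and p_pos: "0 < p" and p_less_1: "p < 1"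
begin

definition P :: "('e \<Rightarrow> bool) pmf" where
  "P = Pi_pmf E False (\<lambda>_. bernoulli_pmf p)"

abbreviation Ex :: "(('e \<Rightarrow> bool) \<Rightarrow> real) \<Rightarrow> real" where
  "Ex \<equiv> measure_pmf.expectation P"

lemma finite_set_P: "finite (set_pmf P)"
  using finite_PiE_dflt[OF finite_E, of "\<lambda>_. UNIV :: bool set" False]
  unfolding P_def
  by (rule finite_subset[OF order.trans[OF set_Pi_pmf_subset[OF finite_E]], rotated])
     (auto simp: PiE_dflt_def)

lemma integrable_P [simp, intro]: "integrable (measure_pmf P) (h :: _ \<Rightarrow> real)"
  by (rule integrable_measure_pmf_finite[OF finite_set_P])

lemma Ex_mono: "(\<And>x. f x \<le> g x) \<Longrightarrow> Ex f \<le> Ex g"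
  by (rule integral_mono) auto

lemma Ex_abs_le: "\<bar>Ex f\<bar> \<le> Ex (\<lambda>x. \<bar>f x\<bar>)"
  by simp

lemma Ex_sum: "Ex (\<lambda>x. \<Sum>i\<in>I. f i x) = (\<Sum>i\<in>I. Ex (f i))"
  by (rule Bochner_Integration.integral_sum) auto

text \<open>One coordinate is averaged out while the integral stays over the whole space; identities
  for a single edge then need no marginal measures.\<close>

lemma Ex_split:
  assumes "k \<in> E"
  shows "Ex h = Ex (\<lambda>x. p * h (x(k := True)) + (1 - p) * h (x(k := False)))"
proof -
  let ?P0 = "Pi_pmf (E - {k}) False (\<lambda>_. bernoulli_pmf p)"
  have fin: "finite (set_pmf ?P0)"
    using finite_PiE_dflt[of "E - {k}" "\<lambda>_. UNIV :: bool set" False] finite_E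
    by (auto intro!: finite_subset[OF set_Pi_pmf_subset] simp: PiE_dflt_def)
  hence int: "integrable (measure_pmf ?P0) (f :: _ \<Rightarrow> real)" for f
    by (rule integrable_measure_pmf_finite)
  have "P = Pi_pmf (insert k (E - {k})) False (\<lambda>_. bernoulli_pmf p)"
    using assms by (simp add: P_def insert_absorb)
  also have "\<dots> = bernoulli_pmf p \<bind> (\<lambda>y. map_pmf (\<lambda>f. f(k := y)) ?P0)"
    using finite_E by (subst Pi_pmf_insert') (auto simp: map_pmf_def)
  finally have P: "P = bernoulli_pmf p \<bind> (\<lambda>y. map_pmf (\<lambda>f. f(k := y)) ?P0)" .
  have *: "Ex h = measure_pmf.expectation ?P0 (\<lambda>x. p * h (x(k := True)) + (1 - p) * h (x(k := False)))" for h
    unfolding P using fin p_pos p_less_1 int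
    by (subst pmf_expectation_bind[of UNIV]) (auto simp: UNIV_bool)
  \<comment> \<open>Both expectations are reduced to the remaining coordinates. On the right the
    integrand no longer sees \<open>x k\<close>, so the weights p and 1 - p add up to 1.\<close>
  show ?thesis
    by (subst (1 2) *) (simp add: algebra_simps)
qed

text \<open>Discrete integration by parts: both values of \<open>x k\<close> receive weight p (1 -
  p), with opposite signs, so a centred factor becomes a difference operator.\<close>

lemma Ex_ibp:
  assumes "k \<in> E"
  shows "Ex (\<lambda>x. (of_bool (x k) - p) * h x)
    = p * (1 - p) * Ex (\<lambda>x. h (x(k := True)) - h (x(k := False)))"
proof -
  have "Ex (\<lambda>x. (of_bool (x k) - p) * h x)
      = Ex (\<lambda>x. p * (1 - p) * (h (x(k := True)) - h (x(k := False))))"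
    by (subst Ex_split[OF assms]) (simp add: algebra_simps)
  thus ?thesis by simp
qed

lemma Ex_ibp_mult:
  assumes "k \<in> E" "\<And>x b. v (x(k := b)) = v x"
  shows "Ex (\<lambda>x. (of_bool (x k) - p) * (v x * h x))
    = p * (1 - p) * Ex (\<lambda>x. v x * (h (x(k := True)) - h (x(k := False))))"
  unfolding Ex_ibp[OF assms(1)] assms(2) by (simp add: right_diff_distrib)

definition mon :: "'e set \<Rightarrow> ('e \<Rightarrow> bool) \<Rightarrow> real" where
  "mon S x = of_bool (\<forall>e\<in>S. x e)"

lemma mon_nonneg: "0 \<le> mon S x"
  by (simp add: mon_def)

lemma mon_mult: "mon S x * mon T x = mon (S \<union> T) x"
  by (auto simp: mon_def)

lemma mon_upd_notin: "k \<notin> S \<Longrightarrow> mon S (x(k := b)) = mon S x"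
  by (auto simp: mon_def)

lemma mon_upd_in: "k \<in> S \<Longrightarrow> mon S (x(k := b)) = of_bool b * mon (S - {k}) x"
  by (auto simp: mon_def)

lemma Ex_mon:
  assumes "S \<subseteq> E" shows "Ex (mon S) = p ^ card S"
proof -
  have "finite S" using assms finite_E finite_subset by blast
  thus ?thesis using assms
  proof induction
    case empty
    thus ?case by (simp add: mon_def[abs_def])
  next
    case (insert k S)
    have "Ex (mon (insert k S)) = Ex (\<lambda>x. p * mon S x)"
      using insert by (subst Ex_split[of k]) (auto simp: mon_upd_in)
    thus ?case using insert by simp
  qed
qed

section \<open>Kolmogorov bounds for functions increasing in each edge\<close>

lemma abs_Ex_le_sqrt: "Ex (\<lambda>x. \<bar>f x\<bar>) \<le> sqrt (Ex (\<lambda>x. (f x)\<^sup>2))"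
proof (rule real_le_rsqrt)
  have "0 \<le> measure_pmf.variance P (\<lambda>x. \<bar>f x\<bar>)"
    by simp
  also have "\<dots> = Ex (\<lambda>x. (f x)\<^sup>2) - (Ex (\<lambda>x. \<bar>f x\<bar>))\<^sup>2"
    by (subst measure_pmf.variance_eq) auto
  finally show "(Ex (\<lambda>x. \<bar>f x\<bar>))\<^sup>2 \<le> Ex (\<lambda>x. (f x)\<^sup>2)" by simp
qed

text \<open>Integration by parts turns E[W f(W)] into differences of f along single edges. Replacing
  each difference by its linear part at W gives the first term, because |f'| \<le> 1. The remainders
  \<open>R\<close> are dominated by \<open>A k\<close> times an increment of \<open>G\<close>, and
  |G| \<le> 2 gives the second.\<close>

theorem kolmogorov_bound:
  fixes V :: "'e \<Rightarrow> ('e \<Rightarrow> bool) \<Rightarrow> real" and W :: "('e \<Rightarrow> bool) \<Rightarrow> real"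
  assumes V_nonneg: "\<And>k x. k \<in> E \<Longrightarrow> 0 \<le> V k x"
    and V_upd: "\<And>k x b. k \<in> E \<Longrightarrow> V k (x(k := b)) = V k x"
    and W_mono: "\<And>k x. k \<in> E \<Longrightarrow> W (x(k := False)) \<le> W (x(k := True))"
    and W_eq: "\<And>x. W x = (\<Sum>k\<in>E. (of_bool (x k) - p) * V k x)"
  defines "A \<equiv> \<lambda>k x. V k x * (W (x(k := True)) - W (x(k := False)))"
  shows "\<bar>measure_pmf.prob P {x. W x \<le> z} - Phi z\<bar> \<le>
    Ex (\<lambda>x. \<bar>1 - p * (1 - p) * (\<Sum>k\<in>E. A k x)\<bar>)
    + 2 * Ex (\<lambda>x. \<bar>\<Sum>k\<in>E. (of_bool (x k) - p) * A k x\<bar>)"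
proof -
  define f f' where "f = Stein_sol z" and "f' = Stein_deriv z"
  define G where "G w = w * f w - of_bool (w \<le> z)" for w
  define q where "q = 1 - p"
  have pq: "0 \<le> p * q" using p_pos p_less_1 by (simp add: q_def)
  let ?pos = "\<lambda>k x. W (x(k := True))" and ?neg = "\<lambda>k x. W (x(k := False))"
  have f': "f' w = w * f w + of_bool (w \<le> z) - Phi z" for w
    by (simp add: f_def f'_def Stein_deriv_def)
  have prob: "measure_pmf.prob P {x. W x \<le> z} = Ex (\<lambda>x. of_bool (W x \<le> z))"
  proof -
    have "(\<lambda>x. of_bool (W x \<le> z)) = (indicator {x. W x \<le> z} :: _ \<Rightarrow> real)"
      by (auto simp: fun_eq_iff)
    thus ?thesis by simp
  qed
  have W_mult: "W x * f (W x) = (\<Sum>k\<in>E. (of_bool (x k) - p) * (V k x * f (W x)))" for x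
    by (subst (1) W_eq) (simp add: sum_distrib_right mult.assoc)
  hence "Ex (\<lambda>x. W x * f (W x)) = Ex (\<lambda>x. \<Sum>k\<in>E. (of_bool (x k) - p) * (V k x * f (W x)))"
    by (simp only: W_mult)
  also have "\<dots> = (\<Sum>k\<in>E. p * q * Ex (\<lambda>x. V k x * (f (?pos k x) - f (?neg k x))))"
    unfolding Ex_sum q_def by (intro sum.cong refl Ex_ibp_mult V_upd)
  finally have stein1: "Ex (\<lambda>x. W x * f (W x)) =
      (\<Sum>k\<in>E. p * q * Ex (\<lambda>x. V k x * (f (?pos k x) - f (?neg k x))))" .
  define R where "R k x = V k x * (f (?pos k x) - f (?neg k x) - (?pos k x - ?neg k x) * f' (W x))" for k x
  have "measure_pmf.prob P {x. W x \<le> z} - Phi z = Ex (\<lambda>x. f' (W x) - W x * f (W x))"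
    by (simp add: prob f')
  also have "\<dots> = Ex (\<lambda>x. f' (W x)) - (\<Sum>k\<in>E. p * q * Ex (\<lambda>x. A k x * f' (W x) + R k x))"
    by (simp add: stein1 R_def A_def algebra_simps)
  also have "\<dots> = Ex (\<lambda>x. f' (W x) * (1 - p * q * (\<Sum>k\<in>E. A k x))) - (\<Sum>k\<in>E. p * q * Ex (R k))"
    by (simp add: algebra_simps sum.distrib Ex_sum sum_distrib_left)
  finally have main: "measure_pmf.prob P {x. W x \<le> z} - Phi z = \<dots>" .
  have "\<bar>Ex (\<lambda>x. f' (W x) * (1 - p * q * (\<Sum>k\<in>E. A k x)))\<bar> \<le>
      Ex (\<lambda>x. \<bar>f' (W x) * (1 - p * q * (\<Sum>k\<in>E. A k x))\<bar>)"
    by (rule Ex_abs_le)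
  also have "\<dots> \<le> Ex (\<lambda>x. \<bar>1 - p * q * (\<Sum>k\<in>E. A k x)\<bar>)"
    unfolding abs_mult f'_def by (intro Ex_mono mult_left_le_one_le abs_Stein_deriv_le_1) auto
  finally have bound1: "\<bar>Ex (\<lambda>x. f' (W x) * (1 - p * q * (\<Sum>k\<in>E. A k x)))\<bar> \<le> \<dots>" .
  have R: "\<bar>R k x\<bar> \<le> A k x * (G (?pos k x) - G (?neg k x))" if k: "k \<in> E" for k x
  proof -
    have "W x = ?pos k x \<or> W x = ?neg k x"
      by (metis (full_types) fun_upd_triv)
    hence "?neg k x \<le> W x" "W x \<le> ?pos k x"
      using W_mono[OF k, of x] by auto
    from mult_left_mono[OF Stein_sol_increment[OF this] V_nonneg[OF k, of x]]
    show ?thesis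
      using V_nonneg[OF k, of x] by (simp add: R_def A_def G_def f_def f'_def abs_mult mult.assoc)
  qed
  have "\<bar>\<Sum>k\<in>E. p * q * Ex (R k)\<bar> \<le> (\<Sum>k\<in>E. p * q * Ex (\<lambda>x. A k x * (G (?pos k x) - G (?neg k x))))"
  proof (rule order.trans[OF sum_abs sum_mono])
    fix k assume k: "k \<in> E"
    have "\<bar>Ex (R k)\<bar> \<le> Ex (\<lambda>x. A k x * (G (?pos k x) - G (?neg k x)))"
      by (rule order.trans[OF Ex_abs_le Ex_mono]) (rule R[OF k])
    thus "\<bar>p * q * Ex (R k)\<bar> \<le> p * q * Ex (\<lambda>x. A k x * (G (?pos k x) - G (?neg k x)))"
      unfolding abs_mult[of "p * q"] abs_of_nonneg[OF pq] using pq by (intro mult_left_mono)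
  qed
  \<comment> \<open>Integration by parts from right to left: \<open>A k\<close> does not involve
    \<open>x k\<close> and its partner is a difference of \<open>G\<close>. The sum over k can now
    be taken before the absolute value, which preserves the cancellation between edges.\<close>
  also have "\<dots> = (\<Sum>k\<in>E. Ex (\<lambda>x. (of_bool (x k) - p) * (A k x * G (W x))))"
    unfolding q_def by (intro sum.cong refl Ex_ibp_mult[symmetric]) (simp_all add: A_def V_upd)
  also have "\<dots> = Ex (\<lambda>x. G (W x) * (\<Sum>k\<in>E. (of_bool (x k) - p) * A k x))"
    by (simp add: Ex_sum sum_distrib_left algebra_simps)
  also have "\<dots> \<le> Ex (\<lambda>x. 2 * \<bar>\<Sum>k\<in>E. (of_bool (x k) - p) * A k x\<bar>)"
  proof (rule Ex_mono)
    fix x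
    have "\<bar>G (W x)\<bar> \<le> 2"
      using Stein_sol_mult_bounds[where z = z and w = "W x"] Phi_nonneg[of z] Phi_le_1[of z]
      by (auto simp: G_def f_def)
    hence "\<bar>G (W x) * (\<Sum>k\<in>E. (of_bool (x k) - p) * A k x)\<bar> \<le> 2 * \<bar>\<Sum>k\<in>E. (of_bool (x k) - p) * A k x\<bar>"
      unfolding abs_mult by (intro mult_right_mono) auto
    thus "G (W x) * (\<Sum>k\<in>E. (of_bool (x k) - p) * A k x) \<le> 2 * \<bar>\<Sum>k\<in>E. (of_bool (x k) - p) * A k x\<bar>"
      by linarith
  qed
  finally have bound2: "\<bar>\<Sum>k\<in>E. p * q * Ex (R k)\<bar> \<le> 2 * Ex (\<lambda>x. \<bar>\<Sum>k\<in>E. (of_bool (x k) - p) * A k x\<bar>)"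
    by simp
  show ?thesis
    using main bound1 bound2 unfolding q_def by linarith
qed

text \<open>Integration by parts with the identity in place of f shows that unit variance means p (1
  - p) E[\<Sum> A_k] = 1. The first term of \<open>kolmogorov_bound\<close> is therefore centred,
  and both terms are passed to second moments.\<close>

corollary kolmogorov_bound_L2:
  fixes V :: "'e \<Rightarrow> ('e \<Rightarrow> bool) \<Rightarrow> real" and W :: "('e \<Rightarrow> bool) \<Rightarrow> real"
  assumes V_nonneg: "\<And>k x. k \<in> E \<Longrightarrow> 0 \<le> V k x"
    and V_upd: "\<And>k x b. k \<in> E \<Longrightarrow> V k (x(k := b)) = V k x"
    and W_mono: "\<And>k x. k \<in> E \<Longrightarrow> W (x(k := False)) \<le> W (x(k := True))"
    and W_eq: "\<And>x. W x = (\<Sum>k\<in>E. (of_bool (x k) - p) * V k x)"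
    and W_norm: "Ex (\<lambda>x. (W x)\<^sup>2) = 1"
  defines "A \<equiv> \<lambda>k x. V k x * (W (x(k := True)) - W (x(k := False)))"
  shows "\<bar>measure_pmf.prob P {x. W x \<le> z} - Phi z\<bar> \<le>
    p * (1 - p) * sqrt (measure_pmf.variance P (\<lambda>x. \<Sum>k\<in>E. A k x))
    + 2 * sqrt (Ex (\<lambda>x. (\<Sum>k\<in>E. (of_bool (x k) - p) * A k x)\<^sup>2))"
proof -
  have W_mult: "W x * W x = (\<Sum>k\<in>E. (of_bool (x k) - p) * (V k x * W x))" for x
    by (subst (1) W_eq) (simp add: sum_distrib_right mult.assoc)
  have "1 = Ex (\<lambda>x. W x * W x)"
    using W_norm by (simp add: power2_eq_square)
  also have "\<dots> = Ex (\<lambda>x. \<Sum>k\<in>E. (of_bool (x k) - p) * (V k x * W x))"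
    by (simp only: W_mult)
  also have "\<dots> = (\<Sum>k\<in>E. p * (1 - p) * Ex (A k))"
    unfolding Ex_sum A_def by (intro sum.cong refl Ex_ibp_mult V_upd)
  finally have mean: "p * (1 - p) * Ex (\<lambda>x. \<Sum>k\<in>E. A k x) = 1"
    by (simp add: Ex_sum sum_distrib_left)
  have "Ex (\<lambda>x. \<bar>1 - p * (1 - p) * (\<Sum>k\<in>E. A k x)\<bar>)
      = Ex (\<lambda>x. p * (1 - p) * \<bar>(\<Sum>k\<in>E. A k x) - Ex (\<lambda>x. \<Sum>k\<in>E. A k x)\<bar>)"
  proof (rule Bochner_Integration.integral_cong[OF refl])
    fix x
    have "\<bar>1 - p * (1 - p) * (\<Sum>k\<in>E. A k x)\<bar>
       = \<bar>p * (1 - p) * ((\<Sum>k\<in>E. A k x) - Ex (\<lambda>x. \<Sum>k\<in>E. A k x))\<bar>"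
      by (subst mean[symmetric]) (simp add: right_diff_distrib abs_minus_commute)
    thus "\<bar>1 - p * (1 - p) * (\<Sum>k\<in>E. A k x)\<bar>
       = p * (1 - p) * \<bar>(\<Sum>k\<in>E. A k x) - Ex (\<lambda>x. \<Sum>k\<in>E. A k x)\<bar>"
      using p_pos p_less_1 by (simp add: abs_mult)
  qed
  also have "\<dots> = p * (1 - p) * Ex (\<lambda>x. \<bar>(\<Sum>k\<in>E. A k x) - Ex (\<lambda>x. \<Sum>k\<in>E. A k x)\<bar>)"
    by simp
  also have "\<dots> \<le> p * (1 - p) * sqrt (measure_pmf.variance P (\<lambda>x. \<Sum>k\<in>E. A k x))"
    using p_pos p_less_1 by (intro mult_left_mono abs_Ex_le_sqrt) auto
  finally have 1: "Ex (\<lambda>x. \<bar>1 - p * (1 - p) * (\<Sum>k\<in>E. A k x)\<bar>) \<le> \<dots>" .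
  have "\<bar>measure_pmf.prob P {x. W x \<le> z} - Phi z\<bar> \<le>
      Ex (\<lambda>x. \<bar>1 - p * (1 - p) * (\<Sum>k\<in>E. A k x)\<bar>)
      + 2 * Ex (\<lambda>x. \<bar>\<Sum>k\<in>E. (of_bool (x k) - p) * A k x\<bar>)"
    unfolding A_def by (rule kolmogorov_bound) (use assms in auto)
  also have "\<dots> \<le> p * (1 - p) * sqrt (measure_pmf.variance P (\<lambda>x. \<Sum>k\<in>E. A k x))
    + 2 * sqrt (Ex (\<lambda>x. (\<Sum>k\<in>E. (of_bool (x k) - p) * A k x)\<^sup>2))"
    by (intro add_mono 1 mult_left_mono abs_Ex_le_sqrt) auto
  finally show ?thesis .
qed

section \<open>Sums of monomials\<close>

lemma variance_sum:
  "measure_pmf.variance P (\<lambda>x. \<Sum>i\<in>D. f i x) =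
     (\<Sum>i\<in>D. \<Sum>j\<in>D. Ex (\<lambda>x. f i x * f j x) - Ex (f i) * Ex (f j))"
proof -
  have "measure_pmf.variance P (\<lambda>x. \<Sum>i\<in>D. f i x) =
      Ex (\<lambda>x. (\<Sum>i\<in>D. f i x)\<^sup>2) - (Ex (\<lambda>x. \<Sum>i\<in>D. f i x))\<^sup>2"
    by (rule measure_pmf.variance_eq) auto
  also have "\<dots> = (\<Sum>i\<in>D. \<Sum>j\<in>D. Ex (\<lambda>x. f i x * f j x)) - (\<Sum>i\<in>D. \<Sum>j\<in>D. Ex (f i) * Ex (f j))"
    by (simp only: power2_eq_square sum_product Ex_sum)
  finally show ?thesis by (simp add: sum_subtractf)
qed

lemma Ex_mon_mult:
  "S \<subseteq> E \<Longrightarrow> T \<subseteq> E \<Longrightarrow> Ex (\<lambda>x. mon S x * mon T x) = p ^ card (S \<union> T)"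
  by (simp add: mon_mult Ex_mon)

lemma variance_sum_mon:
  assumes "\<And>i. i \<in> I \<Longrightarrow> S i \<subseteq> E"
  shows "measure_pmf.variance P (\<lambda>x. \<Sum>i\<in>I. mon (S i) x) =
     (\<Sum>i\<in>I. \<Sum>j\<in>I. p ^ card (S i \<union> S j) - p ^ (card (S i) + card (S j)))"
  unfolding variance_sum
  by (intro sum.cong refl) (use assms in \<open>simp add: Ex_mon_mult Ex_mon power_add\<close>)

text \<open>
  The edges are processed in the order given by \<open>r\<close>. Any order does; the point is that the
  coefficient of \<open>of_bool (x k) - p\<close> is nonnegative and does not involve \<open>x k\<close>.
\<close>

lemma mon_minus_power:
  fixes r :: "'e \<Rightarrow> nat"
  assumes "finite S" "inj_on r S"
  shows "mon S x - p ^ card S =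
    (\<Sum>k\<in>S. (of_bool (x k) - p) * (p ^ card {e\<in>S. r k < r e} * mon {e\<in>S. r e < r k} x))"
  using assms
proof (induction S rule: finite_ranking_induct[where f = r])
  case empty
  thus ?case by (simp add: mon_def)
next
  case (insert a S)
  show ?case
  proof (cases "a \<in> S")
    case True
    with insert show ?thesis by (simp add: insert_absorb)
  next
    case False
    have less: "r e < r a" if "e \<in> S" for e
      using insert.hyps(2)[OF that] insert.prems that False
      by (metis inj_on_eq_iff insertI1 insertI2 le_neq_implies_less)
    have IH: "mon S x - p ^ card S =
      (\<Sum>k\<in>S. (of_bool (x k) - p) * (p ^ card {e\<in>S. r k < r e} * mon {e\<in>S. r e < r k} x))"
      using insert by (auto simp: inj_on_insert)
    have "mon (insert a S) x = of_bool (x a) * mon S x"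
      by (simp add: mon_def)
    \<comment> \<open>The inserted edge a has the highest rank. Its own term carries the whole
      monomial of S, and every earlier term gains one factor p, the mean of a.\<close>
    hence "mon (insert a S) x - p ^ card (insert a S) =
        (of_bool (x a) - p) * mon S x + p * (mon S x - p ^ card S)"
      using insert.hyps False by (simp add: algebra_simps)
    also have "(of_bool (x a) - p) * mon S x = (of_bool (x a) - p) *
        (p ^ card {e\<in>insert a S. r a < r e} * mon {e\<in>insert a S. r e < r a} x)"
    proof -
      have "{e\<in>insert a S. r a < r e} = {}" "{e\<in>insert a S. r e < r a} = S"
        using less by (auto dest: order.strict_trans)
      thus ?thesis by (simp only: card.empty power_0 mult_1)
    qed
    also have "p * (mon S x - p ^ card S) =
      (\<Sum>k\<in>S. (of_bool (x k) - p) * (p ^ card {e\<in>insert a S. r k < r e} * mon {e\<in>insert a S. r e < r k} x))"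
      unfolding IH sum_distrib_left
    proof (rule sum.cong[OF refl])
      fix k assume k: "k \<in> S"
      have "{e\<in>insert a S. r k < r e} = insert a {e\<in>S. r k < r e}"
           "{e\<in>insert a S. r e < r k} = {e\<in>S. r e < r k}"
        using less[OF k] by auto
      thus "p * ((of_bool (x k) - p) * (p ^ card {e\<in>S. r k < r e} * mon {e\<in>S. r e < r k} x)) =
          (of_bool (x k) - p) * (p ^ card {e\<in>insert a S. r k < r e} * mon {e\<in>insert a S. r e < r k} x)"
        using insert.hyps False by simp
    qed
    finally show ?thesis using insert.hyps False by simp
  qed
qed

text \<open>A centred factor whose edge occurs nowhere else integrates to zero, so for distinct k
  and l each edge must lie in the other monomial. Two integrations by parts then produce (p (1 -
  p))^2 and delete both edges from the union; the p^2 restores the exponent.\<close>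

lemma Ex_centered_pair:
  assumes k: "k \<in> E" "k \<notin> S" and l: "l \<in> E" "l \<notin> T" and ST: "S \<subseteq> E" "T \<subseteq> E"
  shows "Ex (\<lambda>x. (of_bool (x k) - p) * mon S x * ((of_bool (x l) - p) * mon T x)) =
    (if k = l then p * (1 - p) * p ^ card (S \<union> T)
     else if k \<in> T \<and> l \<in> S then (1 - p)\<^sup>2 * p ^ card (S \<union> T) else 0)"
proof -
  let ?L = "Ex (\<lambda>x. (of_bool (x k) - p) * mon S x * ((of_bool (x l) - p) * mon T x))"
  have fin: "finite (S \<union> T)" using ST finite_E finite_subset by blast
  consider "k = l" | "k \<noteq> l" "k \<notin> T" | "k \<noteq> l" "l \<notin> S" | "k \<noteq> l" "k \<in> T" "l \<in> S" by blast
  thus ?thesis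
  proof cases
    case 1
    have "?L = Ex (\<lambda>x. (of_bool (x k) - p) * ((of_bool (x k) - p) * mon (S \<union> T) x))"
      using 1 by (simp add: mon_mult[symmetric] mult_ac)
    also have "\<dots> = p * (1 - p) * Ex (mon (S \<union> T))"
      using k l 1 by (subst Ex_ibp) (auto simp: mon_upd_notin algebra_simps)
    finally show ?thesis using 1 ST by (simp add: Ex_mon)
  next
    case 2
    have "?L = Ex (\<lambda>x. (of_bool (x k) - p) * ((of_bool (x l) - p) * mon (S \<union> T) x))"
      by (simp add: mon_mult[symmetric] mult_ac)
    also have "\<dots> = 0"
      using k l 2 by (subst Ex_ibp) (auto simp: mon_upd_notin)
    finally show ?thesis using 2 by simp
  next
    case 3
    have "?L = Ex (\<lambda>x. (of_bool (x l) - p) * ((of_bool (x k) - p) * mon (S \<union> T) x))"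
      by (simp add: mon_mult[symmetric] mult_ac)
    also have "\<dots> = 0"
      using k l 3 by (subst Ex_ibp) (auto simp: mon_upd_notin)
    finally show ?thesis using 3 by simp
  next
    case 4
    have card: "card (S \<union> T) = card (S \<union> T - {k} - {l}) + 2"
    proof -
      have "card {k, l} \<le> card (S \<union> T)"
        by (rule card_mono[OF fin]) (use 4 in auto)
      thus ?thesis using 4 by (auto simp: card_Diff_singleton_if)
    qed
    have "?L = Ex (\<lambda>x. (of_bool (x k) - p) * ((of_bool (x l) - p) * mon (S \<union> T) x))"
      by (simp add: mon_mult[symmetric] mult_ac)
    also have "\<dots> = p * (1 - p) * Ex (\<lambda>x. (of_bool (x l) - p) * mon (S \<union> T - {k}) x)"
      using k 4 by (subst Ex_ibp) (auto simp: mon_upd_in)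
    also have "\<dots> = (p * (1 - p)) * ((p * (1 - p)) * Ex (mon (S \<union> T - {k} - {l})))"
      using l 4 by (subst Ex_ibp) (auto simp: mon_upd_in)
    also have "Ex (mon (S \<union> T - {k} - {l})) = p ^ card (S \<union> T - {k} - {l})"
      using ST by (intro Ex_mon) auto
    also have "(p * (1 - p)) * ((p * (1 - p)) * p ^ card (S \<union> T - {k} - {l})) = (1 - p)\<^sup>2 * p ^ card (S \<union> T)"
      by (simp only: card power_add power2_eq_square mult_ac)
    finally show ?thesis using 4 by simp
  qed
qed

section \<open>Second moments dominated by connected quadruples\<close>

definition linked_weight :: "'e set \<Rightarrow> 'e set \<Rightarrow> 'e set \<Rightarrow> 'e set \<Rightarrow> real" where
  "linked_weight A B A' B' =
     of_bool (A \<inter> B \<noteq> {} \<and> A' \<inter> B' \<noteq> {} \<and> (A \<union> B) \<inter> (A' \<union> B') \<noteq> {}) * p ^ card (A \<union> B \<union> A' \<union> B')"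

lemma power_p_mono: "m \<le> n \<Longrightarrow> p ^ n \<le> p ^ m"
  using p_pos p_less_1 by (intro power_decreasing) auto

lemma card_insert_le_Suc: "card (insert a A) \<le> Suc (card A)"
  by (cases "finite A") (auto simp: card_insert_if)

text \<open>\<open>R\<close>, \<open>R'\<close> hold edges already replaced by their means,
  \<open>T\<close>, \<open>T'\<close> those still random. If \<open>T\<close> and \<open>T'\<close>
  are disjoint, the covariance vanishes. Otherwise the four sets are linked, and their union is
  covered by \<open>R\<close>, \<open>R'\<close>, \<open>T \<union> T'\<close> and the edges k, k',
  for which the prefactor p^2 pays.\<close>

lemma linked_cov_bound:
  assumes sub: "A \<subseteq> E" "B \<subseteq> E" "A' \<subseteq> E" "B' \<subseteq> E"
    and k: "k \<in> A \<inter> B" "k' \<in> A' \<inter> B'"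
    and R: "A \<union> B \<subseteq> insert k (R \<union> T)" "A' \<union> B' \<subseteq> insert k' (R' \<union> T')" "R \<subseteq> E" "R' \<subseteq> E"
    and T: "T \<subseteq> A \<union> B" "T' \<subseteq> A' \<union> B'"
  shows "p\<^sup>2 * (p ^ card R * p ^ card R' * (p ^ card (T \<union> T') - p ^ (card T + card T')))
           \<le> linked_weight A B A' B'"
proof (cases "T \<inter> T' = {}")
  case True
  have "T \<subseteq> E" "T' \<subseteq> E" using T sub by blast+
  hence "finite T" "finite T'" by (simp_all add: finite_subset[OF _ finite_E])
  hence "card (T \<union> T') = card T + card T'" using True by (rule card_Un_disjoint)
  thus ?thesis using p_pos by (simp add: linked_weight_def)
next
  case False
  have fin: "finite (insert k (insert k' (R \<union> R' \<union> (T \<union> T'))))"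
    by (rule finite_subset[OF _ finite_E]) (use T sub R(3,4) k in blast)
  have "card (A \<union> B \<union> A' \<union> B') \<le> card (insert k (insert k' (R \<union> R' \<union> (T \<union> T'))))"
    by (rule card_mono[OF fin]) (use R in auto)
  also have "\<dots> \<le> Suc (Suc (card (R \<union> R' \<union> (T \<union> T'))))"
    by (meson card_insert_le_Suc order.trans Suc_le_mono)
  also have "card (R \<union> R' \<union> (T \<union> T')) \<le> card R + card R' + card (T \<union> T')"
    using card_Un_le[of "R \<union> R'" "T \<union> T'"] card_Un_le[of R R'] by linarith
  finally have "card (A \<union> B \<union> A' \<union> B') \<le> 2 + card R + card R' + card (T \<union> T')" by simp
  hence "p ^ (2 + card R + card R' + card (T \<union> T')) \<le> p ^ card (A \<union> B \<union> A' \<union> B')"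
    by (rule power_p_mono)
  moreover have "(A \<union> B) \<inter> (A' \<union> B') \<noteq> {}" using False T by blast
  hence "linked_weight A B A' B' = p ^ card (A \<union> B \<union> A' \<union> B')"
    using k by (auto simp: linked_weight_def)
  moreover have "p\<^sup>2 * (p ^ card R * p ^ card R' * (p ^ card (T \<union> T') - p ^ (card T + card T'))) \<le>
     p\<^sup>2 * (p ^ card R * p ^ card R' * p ^ card (T \<union> T'))"
    using p_pos by (intro mult_left_mono) auto
  ultimately show ?thesis by (simp add: power_add mult_ac power2_eq_square)
qed

text \<open>Here no prefactor pays for k and k'. If they coincide, the expectation itself supplies
  one p; if each lies in the other monomial, they are already counted in
  \<open>T \<union> T'\<close>; otherwise the expectation is zero. In every case one factor 1 - p is
  retained, as the final rate demands.\<close>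

lemma linked_centered_bound:
  assumes sub: "A \<subseteq> E" "B \<subseteq> E" "A' \<subseteq> E" "B' \<subseteq> E"
    and k: "k \<in> A \<inter> B" "k' \<in> A' \<inter> B'" "k \<notin> T" "k' \<notin> T'"
    and R: "A \<union> B \<subseteq> insert k (R \<union> T)" "A' \<union> B' \<subseteq> insert k' (R' \<union> T')" "R \<subseteq> E" "R' \<subseteq> E"
    and T: "T \<subseteq> A \<union> B" "T' \<subseteq> A' \<union> B'"
  shows "p ^ card R * p ^ card R' *
      Ex (\<lambda>x. (of_bool (x k) - p) * mon T x * ((of_bool (x k') - p) * mon T' x))
      \<le> (1 - p) * linked_weight A B A' B'"
proof -
  have TE: "T \<subseteq> E" "T' \<subseteq> E" and kE: "k \<in> E" "k' \<in> E" using T sub k by blast+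
  have fin: "finite (R \<union> R' \<union> (T \<union> T'))"
    by (rule finite_subset[OF _ finite_E]) (use TE R(3,4) in blast)
  have le: "card (R \<union> R' \<union> (T \<union> T')) \<le> card R + card R' + card (T \<union> T')"
    using card_Un_le[of "R \<union> R'" "T \<union> T'"] card_Un_le[of R R'] by linarith
  note Ex = Ex_centered_pair[OF kE(1) k(3) kE(2) k(4) TE]
  have q: "0 \<le> 1 - p" using p_less_1 by simp
  consider "k = k'" | "k \<noteq> k'" "k \<in> T'" "k' \<in> T" | "k \<noteq> k'" "\<not> (k \<in> T' \<and> k' \<in> T)" by blast
  thus ?thesis
  proof cases
    case 1
    have "card (A \<union> B \<union> A' \<union> B') \<le> card (insert k (R \<union> R' \<union> (T \<union> T')))"
      by (rule card_mono) (use R 1 fin in auto)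
    also have "\<dots> \<le> 1 + (card R + card R' + card (T \<union> T'))"
      using le card_insert_le_Suc[of k "R \<union> R' \<union> (T \<union> T')"] by linarith
    finally have "p ^ (1 + (card R + card R' + card (T \<union> T'))) \<le> p ^ card (A \<union> B \<union> A' \<union> B')"
      by (rule power_p_mono)
    moreover have "linked_weight A B A' B' = p ^ card (A \<union> B \<union> A' \<union> B')"
      using k 1 by (auto simp: linked_weight_def)
    ultimately have "(1 - p) * p ^ (1 + (card R + card R' + card (T \<union> T'))) \<le> (1 - p) * linked_weight A B A' B'"
      using q by (simp add: mult_left_mono)
    thus ?thesis unfolding Ex using 1 by (simp add: power_add mult_ac)
  next
    case 2
    have "card (A \<union> B \<union> A' \<union> B') \<le> card (R \<union> R' \<union> (T \<union> T'))"
      by (rule card_mono) (use R 2 fin in auto)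
    hence "p ^ (card R + card R' + card (T \<union> T')) \<le> p ^ card (A \<union> B \<union> A' \<union> B')"
      using le by (intro power_p_mono) simp
    hence "(1 - p) * p ^ (card R + card R' + card (T \<union> T')) \<le> (1 - p) * p ^ card (A \<union> B \<union> A' \<union> B')"
      using q by (rule mult_left_mono)
    moreover have "linked_weight A B A' B' = p ^ card (A \<union> B \<union> A' \<union> B')"
      using k 2 T by (auto simp: linked_weight_def)
    moreover have "(1 - p)\<^sup>2 * p ^ (card R + card R' + card (T \<union> T')) \<le>
        (1 - p) * p ^ (card R + card R' + card (T \<union> T'))"
      using p_pos p_less_1 by (intro mult_right_mono) (auto simp: power2_eq_square mult_left_le)
    ultimately have "(1 - p)\<^sup>2 * p ^ (card R + card R' + card (T \<union> T')) \<le> (1 - p) * linked_weight A B A' B'"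
      by simp
    thus ?thesis unfolding Ex using 2 by (simp add: power_add mult_ac)
  next
    case 3
    have "0 \<le> linked_weight A B A' B'" using p_pos by (simp add: linked_weight_def)
    thus ?thesis unfolding Ex using 3 q by auto
  qed
qed

definition linked_sum :: "'i set \<Rightarrow> ('i \<Rightarrow> 'e set) \<Rightarrow> real" where
  "linked_sum I S = (\<Sum>a\<in>I. \<Sum>b\<in>I. \<Sum>c\<in>I. \<Sum>d\<in>I. linked_weight (S a) (S b) (S c) (S d))"

text \<open>The 3 adds the coefficients 1 and 2 of the two terms in
  \<open>kolmogorov_bound_L2\<close>. The factor m arises because a quadruple is counted once for
  each common edge of its first pair and of its second pair, hence at most m^2 times under the
  root.\<close>

theorem kolmogorov_bound_sum_mon:
  fixes S :: "'i \<Rightarrow> 'e set" and m :: nat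
  assumes fin_I: "finite I" and S_sub: "\<And>i. i \<in> I \<Longrightarrow> S i \<subseteq> E" and S_card: "\<And>i. i \<in> I \<Longrightarrow> card (S i) \<le> m"
  defines "N \<equiv> \<lambda>x. \<Sum>i\<in>I. mon (S i) x"
  defines "s2 \<equiv> measure_pmf.variance P N"
  assumes s2_pos: "s2 > 0"
  shows "\<bar>measure_pmf.prob P {x. (N x - Ex N) / sqrt s2 \<le> z} - Phi z\<bar> \<le>
    3 * m * sqrt ((1 - p) * linked_sum I S) / s2"
proof -
  define q where "q = 1 - p"
  have q: "0 < q" "q < 1" using p_pos p_less_1 by (auto simp: q_def)
  obtain r :: "'e \<Rightarrow> nat" where r: "inj_on r E"
    using finite_imp_inj_to_nat_seg[OF finite_E] by blast
  have fin_S: "finite (S i)" if "i \<in> I" for i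
    using S_sub[OF that] finite_E finite_subset by blast
  define L H where "L k i = {e \<in> S i. r e < r k}" and "H k i = {e \<in> S i. r k < r e}" for k i
  \<comment> \<open>\<open>v k\<close> differs from the discrete derivative \<open>d k\<close> of N
    in that the edges after k are replaced by their means.\<close>
  define v where "v k x = (\<Sum>i\<in>I. of_bool (k \<in> S i) * (p ^ card (H k i) * mon (L k i) x))" for k x
  define d where "d k x = (\<Sum>i\<in>I. of_bool (k \<in> S i) * mon (S i - {k}) x)" for k x

  have N_eq: "N x - Ex N = (\<Sum>k\<in>E. (of_bool (x k) - p) * v k x)" for x
  proof -
    have "Ex N = (\<Sum>i\<in>I. p ^ card (S i))"
      unfolding N_def Ex_sum by (intro sum.cong refl Ex_mon S_sub)
    hence "N x - Ex N = (\<Sum>i\<in>I. mon (S i) x - p ^ card (S i))"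
      by (simp add: N_def sum_subtractf)
    also have "\<dots> = (\<Sum>i\<in>I. \<Sum>k\<in>S i. (of_bool (x k) - p) * (p ^ card (H k i) * mon (L k i) x))"
      unfolding H_def L_def
      by (intro sum.cong refl mon_minus_power fin_S inj_on_subset[OF r] S_sub)
    also have "\<dots> = (\<Sum>i\<in>I. \<Sum>k\<in>E. of_bool (k \<in> S i) * ((of_bool (x k) - p) * (p ^ card (H k i) * mon (L k i) x)))"
      using S_sub finite_E by (intro sum.cong refl sum.mono_neutral_cong_left) auto
    also have "\<dots> = (\<Sum>k\<in>E. (of_bool (x k) - p) * v k x)"
      by (subst sum.swap) (simp add: v_def sum_distrib_left mult_ac)
    finally show ?thesis .
  qed

  have N_diff: "N (x(k := True)) - N (x(k := False)) = d k x" for x k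
    unfolding N_def d_def sum_subtractf[symmetric]
    by (intro sum.cong refl) (auto simp: mon_upd_in mon_upd_notin)

  define s where "s = sqrt s2"
  have s: "s > 0" "s\<^sup>2 = s2" using s2_pos by (auto simp: s_def)
  define V W where "V k x = v k x / s" and "W x = (N x - Ex N) / s" for k x
  have v_nonneg: "0 \<le> v k x" for k x
    using p_pos by (auto simp: v_def mon_nonneg intro!: sum_nonneg)
  have d_nonneg: "0 \<le> d k x" for k x
    by (auto simp: d_def mon_nonneg intro!: sum_nonneg)
  have v_upd: "v k (x(k := b)) = v k x" for k x b
    unfolding v_def by (intro sum.cong refl) (simp add: L_def mon_upd_notin)
  have W_diff: "W (x(k := True)) - W (x(k := False)) = d k x / s" for k x
    unfolding W_def N_diff[symmetric] by (simp add: diff_divide_distrib)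

  \<comment> \<open>A triple \<open>(k, i, j)\<close> is a pair of sets with common edge k, from
    expanding \<open>v k\<close> times \<open>d k\<close>. The deterministic factor of the later
    edges goes into \<open>c\<close>, the edges that remain random into \<open>T\<close>.\<close>
  define c T where "c = (\<lambda>(k, i, j). of_bool (k \<in> S i \<inter> S j) * p ^ card (H k i))"
    and "T = (\<lambda>(k, i, j). L k i \<union> (S j - {k}))"
  let ?D = "E \<times> I \<times> I"
  have cover: "S i \<union> S j \<subseteq> insert k (H k i \<union> T (k, i, j))" if "k \<in> E" "i \<in> I" for k i j
  proof -
    have "e \<in> H k i \<union> L k i" if e: "e \<in> S i" "e \<noteq> k" for e
    proof -
      have "e \<in> E" using S_sub \<open>i \<in> I\<close> e by blast
      hence "r e \<noteq> r k" using inj_onD[OF r _ _ \<open>k \<in> E\<close>, of e] e by blast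
      thus ?thesis using e by (auto simp: H_def L_def)
    qed
    thus ?thesis by (auto simp: T_def)
  qed
  define a where "a k x = v k x * d k x" for k x
  have a_eq: "a k x = (\<Sum>(i,j)\<in>I \<times> I. c (k,i,j) * mon (T (k,i,j)) x)" for k x
    unfolding a_def v_def d_def sum_product sum.cartesian_product[symmetric]
    by (intro sum.cong refl) (auto simp: c_def T_def mon_mult[symmetric])
  have sum_a: "(\<Sum>k\<in>E. h k x * a k x) = (\<Sum>t\<in>?D. c t * (h (fst t) x * mon (T t) x))" for h x
  proof -
    have "(\<Sum>k\<in>E. h k x * a k x) = (\<Sum>k\<in>E. \<Sum>ij\<in>I \<times> I. c (k, ij) * (h k x * mon (T (k, ij)) x))"
      unfolding a_eq sum_distrib_left by (intro sum.cong refl) (auto simp: mult_ac)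
    thus ?thesis by (simp add: sum.cartesian_product case_prod_unfold)
  qed

  define w where "w t u = of_bool (fst t \<in> S (fst (snd t)) \<inter> S (snd (snd t))) *
      (of_bool (fst u \<in> S (fst (snd u)) \<inter> S (snd (snd u))) *
      linked_weight (S (fst (snd t))) (S (snd (snd t))) (S (fst (snd u))) (S (snd (snd u))))" for t u
  have sum_w: "(\<Sum>t\<in>?D. \<Sum>u\<in>?D. w t u) \<le> m\<^sup>2 * linked_sum I S"
  proof -
    have card: "(\<Sum>k\<in>E. of_bool (k \<in> S i \<inter> S j)) \<le> real m" if "i \<in> I" for i j
    proof -
      have "(\<Sum>k\<in>E. of_bool (k \<in> S i \<inter> S j)) = real (card {k\<in>E. k \<in> S i \<inter> S j})"
        using finite_E by (simp add: of_bool_def sum.If_cases Int_def)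
      also have "\<dots> \<le> real (card (S i))"
        using fin_S[OF that] by (intro of_nat_mono card_mono) auto
      also have "\<dots> \<le> m" using S_card[OF that] by simp
      finally show ?thesis .
    qed
    let ?g = "\<lambda>t. of_bool (fst t \<in> S (fst (snd t)) \<inter> S (snd (snd t))) :: real"
    let ?l = "\<lambda>ij kl. linked_weight (S (fst ij)) (S (snd ij)) (S (fst kl)) (S (snd kl))"
    have l_nonneg: "0 \<le> ?l ij kl" for ij kl
      using p_pos by (simp add: linked_weight_def)
    have g_nonneg: "0 \<le> ?g t" for t
      by simp
    have step: "(\<Sum>t\<in>?D. ?g t * F (snd t)) \<le> m * (\<Sum>ij\<in>I \<times> I. F ij)"
      if "\<And>ij. 0 \<le> F ij" for F :: "'i \<times> 'i \<Rightarrow> real"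
    proof -
      have "(\<Sum>t\<in>?D. ?g t * F (snd t)) = (\<Sum>k\<in>E. \<Sum>ij\<in>I \<times> I. ?g (k, ij) * F ij)"
        by (simp add: sum.cartesian_product case_prod_unfold)
      also have "\<dots> = (\<Sum>ij\<in>I \<times> I. (\<Sum>k\<in>E. ?g (k, ij)) * F ij)"
        by (subst sum.swap) (simp only: sum_distrib_right)
      also have "\<dots> \<le> (\<Sum>ij\<in>I \<times> I. m * F ij)"
      proof (intro sum_mono mult_right_mono that)
        fix ij assume "ij \<in> I \<times> I"
        thus "(\<Sum>k\<in>E. ?g (k, ij)) \<le> real m"
          using card[of "fst ij" "snd ij"] by (simp only: fst_conv snd_conv mem_Times_iff)
      qed
      finally show ?thesis by (simp only: sum_distrib_left)
    qed
    have "(\<Sum>t\<in>?D. \<Sum>u\<in>?D. w t u) = (\<Sum>t\<in>?D. ?g t * (\<Sum>u\<in>?D. ?g u * ?l (snd t) (snd u)))"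
      by (simp only: w_def sum_distrib_left)
    also have "\<dots> \<le> m * (\<Sum>ij\<in>I \<times> I. \<Sum>u\<in>?D. ?g u * ?l ij (snd u))"
      by (rule step) (intro sum_nonneg mult_nonneg_nonneg l_nonneg g_nonneg)
    also have "\<dots> \<le> m * (\<Sum>ij\<in>I \<times> I. m * (\<Sum>kl\<in>I \<times> I. ?l ij kl))"
      by (intro mult_left_mono sum_mono step l_nonneg) auto
    also have "\<dots> = m\<^sup>2 * linked_sum I S"
      by (simp only: linked_sum_def sum.cartesian_product' fst_conv snd_conv)
         (simp add: sum_distrib_left power2_eq_square mult.assoc)
    finally show ?thesis .
  qed

  \<comment> \<open>The p^2 is the square of the p in the prefactor of
    \<open>kolmogorov_bound_L2\<close>. It must stay with the variance, since the common edges k, k'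
    need not occur in the monomials.\<close>
  have var_a: "p\<^sup>2 * measure_pmf.variance P (\<lambda>x. \<Sum>k\<in>E. a k x) \<le> m\<^sup>2 * linked_sum I S"
  proof -
    have "(\<lambda>x. \<Sum>k\<in>E. a k x) = (\<lambda>x. \<Sum>t\<in>?D. c t * mon (T t) x)"
      using sum_a[of "\<lambda>_ _. 1"] by simp
    hence "p\<^sup>2 * measure_pmf.variance P (\<lambda>x. \<Sum>k\<in>E. a k x) =
        p\<^sup>2 * measure_pmf.variance P (\<lambda>x. \<Sum>t\<in>?D. c t * mon (T t) x)"
      by (simp only: fun_eq_iff)
    also have "\<dots> = (\<Sum>t\<in>?D. \<Sum>u\<in>?D. p\<^sup>2 *
       (Ex (\<lambda>x. c t * mon (T t) x * (c u * mon (T u) x)) - Ex (\<lambda>x. c t * mon (T t) x) * Ex (\<lambda>x. c u * mon (T u) x)))"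
      unfolding variance_sum[of "\<lambda>t x. c t * mon (T t) x" ?D] sum_distrib_left ..
    also have "\<dots> \<le> (\<Sum>t\<in>?D. \<Sum>u\<in>?D. w t u)"
    proof (intro sum_mono)
      fix t u assume tu: "t \<in> ?D" "u \<in> ?D"
      obtain k i j where t: "t = (k, i, j)" by (cases t) auto
      obtain k' i' j' where u: "u = (k', i', j')" by (cases u) auto
      have ij: "k \<in> E" "i \<in> I" "j \<in> I" "k' \<in> E" "i' \<in> I" "j' \<in> I" using tu t u by auto
      have TE: "T t \<subseteq> E" "T u \<subseteq> E"
        using S_sub[OF ij(2)] S_sub[OF ij(3)] S_sub[OF ij(5)] S_sub[OF ij(6)]
        by (auto simp: T_def t u L_def)
      have "Ex (\<lambda>x. c t * mon (T t) x * (c u * mon (T u) x)) - Ex (\<lambda>x. c t * mon (T t) x) * Ex (\<lambda>x. c u * mon (T u) x)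
         = c t * c u * (Ex (\<lambda>x. mon (T t) x * mon (T u) x) - Ex (mon (T t)) * Ex (mon (T u)))"
        by (simp add: algebra_simps)
      also have "\<dots> = c t * c u * (p ^ card (T t \<union> T u) - p ^ (card (T t) + card (T u)))"
        using TE by (simp add: Ex_mon Ex_mon_mult power_add)
      finally have *: "Ex (\<lambda>x. c t * mon (T t) x * (c u * mon (T u) x)) - Ex (\<lambda>x. c t * mon (T t) x) * Ex (\<lambda>x. c u * mon (T u) x)
         = \<dots>" .
      show "p\<^sup>2 * (Ex (\<lambda>x. c t * mon (T t) x * (c u * mon (T u) x)) - Ex (\<lambda>x. c t * mon (T t) x) * Ex (\<lambda>x. c u * mon (T u) x)) \<le> w t u"
      proof (cases "k \<in> S i \<inter> S j \<and> k' \<in> S i' \<inter> S j'")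
        case False
        thus ?thesis unfolding * by (auto simp: c_def w_def t u)
      next
        case True
        have "p\<^sup>2 * (p ^ card (H k i) * p ^ card (H k' i') * (p ^ card (T t \<union> T u) - p ^ (card (T t) + card (T u))))
            \<le> linked_weight (S i) (S j) (S i') (S j')"
        proof (rule linked_cov_bound)
          show "S i \<union> S j \<subseteq> insert k (H k i \<union> T t)" "S i' \<union> S j' \<subseteq> insert k' (H k' i' \<union> T u)"
            unfolding t u using cover ij by blast+
          show "H k i \<subseteq> E" "H k' i' \<subseteq> E" using ij S_sub by (auto simp: H_def)
          show "T t \<subseteq> S i \<union> S j" "T u \<subseteq> S i' \<union> S j'" by (auto simp: T_def t u L_def)
        qed (use True ij S_sub in auto)
        thus ?thesis unfolding * using True by (simp add: w_def t u c_def)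
      qed
    qed
    finally show ?thesis using sum_w by linarith
  qed

  have sq_a: "Ex (\<lambda>x. (\<Sum>k\<in>E. (of_bool (x k) - p) * a k x)\<^sup>2) \<le> q * (m\<^sup>2 * linked_sum I S)"
  proof -
    let ?Y = "\<lambda>t x. (of_bool (x (fst t)) - p) * mon (T t) x"
    have Y: "(\<Sum>k\<in>E. (of_bool (x k) - p) * a k x) = (\<Sum>t\<in>?D. c t * ?Y t x)" for x
      by (rule sum_a[of "\<lambda>k x. of_bool (x k) - p"])
    have "Ex (\<lambda>x. (\<Sum>k\<in>E. (of_bool (x k) - p) * a k x)\<^sup>2) =
        (\<Sum>t\<in>?D. \<Sum>u\<in>?D. Ex (\<lambda>x. c t * ?Y t x * (c u * ?Y u x)))"
      by (simp only: Y power2_eq_square sum_product Ex_sum)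
    also have "\<dots> \<le> (\<Sum>t\<in>?D. \<Sum>u\<in>?D. q * w t u)"
    proof (intro sum_mono)
      fix t u assume tu: "t \<in> ?D" "u \<in> ?D"
      obtain k i j where t: "t = (k, i, j)" by (cases t) auto
      obtain k' i' j' where u: "u = (k', i', j')" by (cases u) auto
      have ij: "k \<in> E" "i \<in> I" "j \<in> I" "k' \<in> E" "i' \<in> I" "j' \<in> I" using tu t u by auto
      have *: "Ex (\<lambda>x. c t * ?Y t x * (c u * ?Y u x)) = c t * c u * Ex (\<lambda>x. ?Y t x * ?Y u x)"
      proof -
        have "c t * ?Y t x * (c u * ?Y u x) = (c t * c u) * (?Y t x * ?Y u x)" for x
          by (simp only: mult_ac)
        thus ?thesis by (simp only: integral_mult_right_zero)
      qed
      show "Ex (\<lambda>x. c t * ?Y t x * (c u * ?Y u x)) \<le> q * w t u"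
      proof (cases "k \<in> S i \<inter> S j \<and> k' \<in> S i' \<inter> S j'")
        case False
        thus ?thesis unfolding * by (auto simp: c_def w_def t u)
      next
        case True
        have "p ^ card (H k i) * p ^ card (H k' i') *
            Ex (\<lambda>x. (of_bool (x k) - p) * mon (T t) x * ((of_bool (x k') - p) * mon (T u) x))
            \<le> (1 - p) * linked_weight (S i) (S j) (S i') (S j')"
        proof (rule linked_centered_bound)
          show "S i \<union> S j \<subseteq> insert k (H k i \<union> T t)" "S i' \<union> S j' \<subseteq> insert k' (H k' i' \<union> T u)"
            unfolding t u using cover ij by blast+
          show "H k i \<subseteq> E" "H k' i' \<subseteq> E" using ij S_sub by (auto simp: H_def)
          show "T t \<subseteq> S i \<union> S j" "T u \<subseteq> S i' \<union> S j'" "k \<notin> T t" "k' \<notin> T u" by (auto simp: T_def t u L_def)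
        qed (use True ij S_sub in auto)
        thus ?thesis unfolding * using True by (simp add: w_def t u c_def q_def)
      qed
    qed
    also have "\<dots> = q * (\<Sum>t\<in>?D. \<Sum>u\<in>?D. w t u)"
      by (simp only: sum_distrib_left)
    finally show ?thesis using mult_left_mono[OF sum_w, of q] q by linarith
  qed

  have Q_nonneg: "0 \<le> linked_sum I S"
    unfolding linked_sum_def linked_weight_def using p_pos by (intro sum_nonneg) auto
  have VW: "V k x * (W (x(k := True)) - W (x(k := False))) = a k x / s2" for k x
    unfolding W_diff by (simp add: V_def a_def power2_eq_square flip: s(2))
  have "\<bar>measure_pmf.prob P {x. W x \<le> z} - Phi z\<bar> \<le>
      p * (1 - p) * sqrt (measure_pmf.variance P (\<lambda>x. \<Sum>k\<in>E. V k x * (W (x(k := True)) - W (x(k := False)))))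
      + 2 * sqrt (Ex (\<lambda>x. (\<Sum>k\<in>E. (of_bool (x k) - p) * (V k x * (W (x(k := True)) - W (x(k := False)))))\<^sup>2))"
  proof (rule kolmogorov_bound_L2)
    show "W x = (\<Sum>k\<in>E. (of_bool (x k) - p) * V k x)" for x
      by (simp add: W_def V_def N_eq sum_divide_distrib)
    have "Ex (\<lambda>x. (W x)\<^sup>2) = s2 / s\<^sup>2"
      by (simp add: W_def power_divide s2_def)
    thus "Ex (\<lambda>x. (W x)\<^sup>2) = 1" using s s2_pos by simp
    show "W (x(k := False)) \<le> W (x(k := True))" for k x
    proof -
      have "0 \<le> W (x(k := True)) - W (x(k := False))"
        unfolding W_diff using d_nonneg s(1) by (rule divide_nonneg_pos)
      thus ?thesis by simp
    qed
  qed (use s in \<open>auto simp: V_def v_nonneg v_upd\<close>)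
  also have "p * (1 - p) * sqrt (measure_pmf.variance P (\<lambda>x. \<Sum>k\<in>E. V k x * (W (x(k := True)) - W (x(k := False)))))
      + 2 * sqrt (Ex (\<lambda>x. (\<Sum>k\<in>E. (of_bool (x k) - p) * (V k x * (W (x(k := True)) - W (x(k := False)))))\<^sup>2))
     = (q * sqrt (p\<^sup>2 * measure_pmf.variance P (\<lambda>x. \<Sum>k\<in>E. a k x))
      + 2 * sqrt (Ex (\<lambda>x. (\<Sum>k\<in>E. (of_bool (x k) - p) * a k x)\<^sup>2))) / s2"
  proof -
    have "measure_pmf.variance P (\<lambda>x. \<Sum>k\<in>E. a k x / s2) = measure_pmf.variance P (\<lambda>x. \<Sum>k\<in>E. a k x) / s2\<^sup>2"
      by (simp only: sum_divide_distrib[symmetric] integral_divide_zero diff_divide_distrib[symmetric] power_divide)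
    moreover have "Ex (\<lambda>x. (\<Sum>k\<in>E. (of_bool (x k) - p) * (a k x / s2))\<^sup>2) =
        Ex (\<lambda>x. (\<Sum>k\<in>E. (of_bool (x k) - p) * a k x)\<^sup>2) / s2\<^sup>2"
      by (simp only: sum_divide_distrib[symmetric] times_divide_eq_right integral_divide_zero power_divide)
    ultimately show ?thesis
      unfolding VW q_def using s2_pos p_pos
      by (simp add: real_sqrt_divide real_sqrt_mult add_divide_distrib)
  qed
  also have "\<dots> \<le> (1 * sqrt (q * (m\<^sup>2 * linked_sum I S)) + 2 * sqrt (q * (m\<^sup>2 * linked_sum I S))) / s2"
  proof (rule divide_right_mono[OF add_mono])
    have "q * sqrt (p\<^sup>2 * measure_pmf.variance P (\<lambda>x. \<Sum>k\<in>E. a k x)) \<le> q * sqrt (m\<^sup>2 * linked_sum I S)"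
      using q var_a by (intro mult_left_mono) auto
    also have "\<dots> = sqrt (q * (q * (m\<^sup>2 * linked_sum I S)))"
      using q by (simp add: real_sqrt_mult)
    \<comment> \<open>One factor q \<le> 1 is given up, so that both terms take the same
      form.\<close>
    also have "\<dots> \<le> sqrt (1 * (q * (m\<^sup>2 * linked_sum I S)))"
      using q Q_nonneg by (intro real_sqrt_le_mono mult_right_mono) auto
    finally show "q * sqrt (p\<^sup>2 * measure_pmf.variance P (\<lambda>x. \<Sum>k\<in>E. a k x)) \<le> 1 * sqrt (q * (m\<^sup>2 * linked_sum I S))"
      by simp
  qed (use sq_a s2_pos in auto)
  also have "\<dots> = 3 * m * sqrt (q * linked_sum I S) / s2"
    by (simp add: real_sqrt_mult mult_ac)
  finally show ?thesis by (simp add: W_def s_def q_def)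
qed

end

section \<open>Adding the sets of a connected quadruple one by one\<close>

lemma card_Un_Diff:
  assumes "finite A" "finite B"
  shows "card (A \<union> B) = card A + card (B - A)"
proof -
  have "A \<union> B = A \<union> (B - A)" by blast
  thus ?thesis using assms by (metis card_Un_disjoint Diff_disjoint finite_Diff)
qed

context bernoulli_field
begin

text \<open>After a and b, at least one of c and d meets the union of the first two sets, and the
  other one then meets the union of three; the two possible orders give the factor 2. Each set after
  the first must meet a union \<open>U\<close> of at most three earlier sets, whence 3 * m, and
  costs \<open>M\<close> uniformly in \<open>U\<close>.\<close>

lemma linked_sum_le:
  fixes S :: "'i \<Rightarrow> 'e set" and m :: nat
  assumes fin_I: "finite I" and S_sub: "\<And>i. i \<in> I \<Longrightarrow> S i \<subseteq> E" and S_card: "\<And>i. i \<in> I \<Longrightarrow> card (S i) \<le> m"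
    and M: "\<And>U. U \<subseteq> E \<Longrightarrow> card U \<le> 3 * m \<Longrightarrow>
       (\<Sum>i\<in>I. of_bool (S i \<inter> U \<noteq> {}) * p ^ card (S i - U)) \<le> M"
    and L: "(\<Sum>i\<in>I. p ^ card (S i)) \<le> L"
  shows "linked_sum I S \<le> 2 * L * M ^ 3"
proof -
  define g where "g U i = of_bool (S i \<inter> U \<noteq> {}) * p ^ card (S i - U)" for U i
  have g_nonneg: "0 \<le> g U i" for U i using p_pos by (simp add: g_def)
  have fin_S: "finite (S i)" if "i \<in> I" for i
    using finite_subset[OF S_sub[OF that] finite_E] .
  have gM: "(\<Sum>i\<in>I. g U i) \<le> M" if "U \<subseteq> E" "card U \<le> 3 * m" for U
    unfolding g_def by (rule M[OF that])
  have M_nonneg: "0 \<le> M"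
    using gM[of "{}"] g_nonneg sum_nonneg[of I "g {}"] by simp
  have c2: "card (S a \<union> S b) \<le> 3 * m" if "a \<in> I" "b \<in> I" for a b
    using card_Un_le[of "S a" "S b"] S_card[OF that(1)] S_card[OF that(2)] by linarith
  have c3: "card (S a \<union> S b \<union> S c) \<le> 3 * m" if "a \<in> I" "b \<in> I" "c \<in> I" for a b c
    using card_Un_le[of "S a \<union> S b" "S c"] card_Un_le[of "S a" "S b"]
      S_card[OF that(1)] S_card[OF that(2)] S_card[OF that(3)] by linarith
  have c1: "card (S a) \<le> 3 * m" if "a \<in> I" for a
    using S_card[OF that] by linarith
  have lw: "linked_weight (S a) (S b) (S c) (S d) \<le>
      p ^ card (S a) * (g (S a) b * (g (S a \<union> S b) c * g (S a \<union> S b \<union> S c) d +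
                                     g (S a \<union> S b) d * g (S a \<union> S b \<union> S d) c))"
    if "a \<in> I" "b \<in> I" "c \<in> I" "d \<in> I" for a b c d
  proof (cases "S a \<inter> S b \<noteq> {} \<and> S c \<inter> S d \<noteq> {} \<and> (S a \<union> S b) \<inter> (S c \<union> S d) \<noteq> {}")
    case False
    hence "linked_weight (S a) (S b) (S c) (S d) = 0" by (auto simp: linked_weight_def)
    thus ?thesis using g_nonneg p_pos by simp
  next
    case True
    have fin: "finite (S a)" "finite (S b)" "finite (S c)" "finite (S d)" using that fin_S by auto
    have 1: "p ^ card (S a \<union> S b \<union> S c \<union> S d) = p ^ card (S a) * p ^ card (S b - S a) *
        p ^ card (S c - (S a \<union> S b)) * p ^ card (S d - (S a \<union> S b \<union> S c))"
      using fin by (simp only: card_Un_Diff finite_Un power_add)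
    have eq: "S a \<union> S b \<union> S c \<union> S d = S a \<union> S b \<union> S d \<union> S c" by blast
    have 2: "p ^ card (S a \<union> S b \<union> S c \<union> S d) = p ^ card (S a) * p ^ card (S b - S a) *
        p ^ card (S d - (S a \<union> S b)) * p ^ card (S c - (S a \<union> S b \<union> S d))"
      unfolding eq using fin by (simp only: card_Un_Diff finite_Un power_add)
    have lw_eq: "linked_weight (S a) (S b) (S c) (S d) = p ^ card (S a \<union> S b \<union> S c \<union> S d)"
      using True by (simp add: linked_weight_def)
    have gb: "g (S a) b = p ^ card (S b - S a)"
      using True by (auto simp: g_def)
    show ?thesis
    proof (cases "S c \<inter> (S a \<union> S b) = {}")
      case False
      hence "g (S a \<union> S b) c = p ^ card (S c - (S a \<union> S b))" by (simp add: g_def)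
      moreover have "S d \<inter> (S a \<union> S b \<union> S c) \<noteq> {}" using True by blast
      hence "g (S a \<union> S b \<union> S c) d = p ^ card (S d - (S a \<union> S b \<union> S c))" by (simp add: g_def)
      ultimately have "linked_weight (S a) (S b) (S c) (S d) =
          p ^ card (S a) * (g (S a) b * (g (S a \<union> S b) c * g (S a \<union> S b \<union> S c) d))"
        unfolding lw_eq 1 gb by (simp only: mult.assoc)
      also have "\<dots> \<le> p ^ card (S a) * (g (S a) b * (g (S a \<union> S b) c * g (S a \<union> S b \<union> S c) d +
                                     g (S a \<union> S b) d * g (S a \<union> S b \<union> S d) c))"
        using g_nonneg p_pos by (intro mult_left_mono) auto
      finally show ?thesis .
    next
      case F: True
      hence "S d \<inter> (S a \<union> S b) \<noteq> {}" using True by blast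
      hence "g (S a \<union> S b) d = p ^ card (S d - (S a \<union> S b))" by (simp add: g_def)
      moreover have "S c \<inter> (S a \<union> S b \<union> S d) \<noteq> {}" using True by blast
      hence "g (S a \<union> S b \<union> S d) c = p ^ card (S c - (S a \<union> S b \<union> S d))" by (simp add: g_def)
      ultimately have "linked_weight (S a) (S b) (S c) (S d) =
          p ^ card (S a) * (g (S a) b * (g (S a \<union> S b) d * g (S a \<union> S b \<union> S d) c))"
        unfolding lw_eq 2 gb by (simp only: mult.assoc)
      also have "\<dots> \<le> p ^ card (S a) * (g (S a) b * (g (S a \<union> S b) c * g (S a \<union> S b \<union> S c) d +
                                     g (S a \<union> S b) d * g (S a \<union> S b \<union> S d) c))"
        using g_nonneg p_pos by (intro mult_left_mono) auto
      finally show ?thesis .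
    qed
  qed
  have chain: "(\<Sum>c\<in>I. \<Sum>d\<in>I. g (S a \<union> S b) c * g (S a \<union> S b \<union> S c) d) \<le> M\<^sup>2"
    if ab: "a \<in> I" "b \<in> I" for a b
  proof -
    have "(\<Sum>c\<in>I. \<Sum>d\<in>I. g (S a \<union> S b) c * g (S a \<union> S b \<union> S c) d) =
        (\<Sum>c\<in>I. g (S a \<union> S b) c * (\<Sum>d\<in>I. g (S a \<union> S b \<union> S c) d))"
      by (simp only: sum_distrib_left)
    also have "\<dots> \<le> (\<Sum>c\<in>I. g (S a \<union> S b) c * M)"
      using ab by (intro sum_mono mult_left_mono g_nonneg gM c3 Un_least S_sub)
    also have "\<dots> = (\<Sum>c\<in>I. g (S a \<union> S b) c) * M"
      by (simp only: sum_distrib_right)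
    also have "\<dots> \<le> M * M"
      using ab by (intro mult_right_mono gM M_nonneg c2 Un_least S_sub)
    finally show ?thesis by (simp only: power2_eq_square)
  qed
  have "linked_sum I S \<le> (\<Sum>a\<in>I. \<Sum>b\<in>I. \<Sum>c\<in>I. \<Sum>d\<in>I.
      p ^ card (S a) * (g (S a) b * (g (S a \<union> S b) c * g (S a \<union> S b \<union> S c) d +
                                     g (S a \<union> S b) d * g (S a \<union> S b \<union> S d) c)))"
    unfolding linked_sum_def by (intro sum_mono lw)
  also have "\<dots> = (\<Sum>a\<in>I. p ^ card (S a) * (\<Sum>b\<in>I. g (S a) b * (
      (\<Sum>c\<in>I. \<Sum>d\<in>I. g (S a \<union> S b) c * g (S a \<union> S b \<union> S c) d) +
      (\<Sum>c\<in>I. \<Sum>d\<in>I. g (S a \<union> S b) d * g (S a \<union> S b \<union> S d) c))))"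
    by (simp only: sum_distrib_left sum.distrib distrib_left)
  also have "\<dots> \<le> (\<Sum>a\<in>I. p ^ card (S a) * (\<Sum>b\<in>I. g (S a) b * (M\<^sup>2 + M\<^sup>2)))"
  proof (intro sum_mono mult_left_mono add_mono chain g_nonneg)
    fix a b assume ab: "a \<in> I" "b \<in> I"
    show "(\<Sum>c\<in>I. \<Sum>d\<in>I. g (S a \<union> S b) d * g (S a \<union> S b \<union> S d) c) \<le> M\<^sup>2"
      by (subst sum.swap) (rule chain[OF ab])
  qed (use p_pos in auto)
  also have "\<dots> = (\<Sum>a\<in>I. p ^ card (S a) * ((\<Sum>b\<in>I. g (S a) b) * (M\<^sup>2 + M\<^sup>2)))"
    by (simp only: sum_distrib_right)
  also have "\<dots> \<le> (\<Sum>a\<in>I. p ^ card (S a) * (M * (M\<^sup>2 + M\<^sup>2)))"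
    using p_pos by (intro sum_mono mult_left_mono mult_right_mono gM S_sub c1) auto
  also have "\<dots> = (\<Sum>a\<in>I. p ^ card (S a)) * (M * (M\<^sup>2 + M\<^sup>2))"
    by (simp only: sum_distrib_right)
  also have "\<dots> \<le> L * (M * (M\<^sup>2 + M\<^sup>2))"
    using M_nonneg by (intro mult_right_mono L) auto
  finally show ?thesis by (simp add: power3_eq_cube power2_eq_square algebra_simps)
qed

end

lemma finite_edges: "simple_graph G \<Longrightarrow> finite (edges G)"
  unfolding simple_graph_def by (rule finite_subset[of _ "Pow (verts G)"]) auto

lemma edges_complete_graph: "edges (complete_graph n) = {e. e \<subseteq> {..<n} \<and> card e = 2}"
  and verts_complete_graph: "verts (complete_graph n) = {..<n}"
  by (simp_all add: complete_graph_def)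

lemma finite_edges_complete_graph: "finite (edges (complete_graph n))"
  unfolding edges_complete_graph by (rule finite_subset[of _ "Pow {..<n}"]) auto

section \<open>Copies of a fixed graph\<close>

locale pattern_graph =
  fixes G :: "'a ugraph"
  assumes simple: "simple_graph G" and nonempty: "verts G \<noteq> {}" and no_isolated: "no_isolated_vertices G"
begin

text \<open>Extensional maps: each injection of the vertex set is counted exactly once, and the set
  is finite.\<close>

definition emb :: "nat \<Rightarrow> ('a \<Rightarrow> nat) set" where
  "emb n = {f \<in> verts G \<rightarrow>\<^sub>E {..<n}. inj_on f (verts G)}"

definition img :: "('a \<Rightarrow> 'b) \<Rightarrow> 'b ugraph" where
  "img f = UGraph (f ` verts G) ((`) f ` edges G)"

definition copies :: "nat \<Rightarrow> nat ugraph set" where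
  "copies n = {H. subgraph H (complete_graph n) \<and> graph_iso H G}"

lemma finite_verts: "finite (verts G)" and edge_subset: "e \<in> edges G \<Longrightarrow> e \<subseteq> verts G"
  and card_edge: "e \<in> edges G \<Longrightarrow> card e = 2"
  using simple by (auto simp: simple_graph_def)

lemma finite_emb: "finite (emb n)"
proof -
  have "finite (verts G \<rightarrow>\<^sub>E {..<n})" by (intro finite_PiE finite_verts) auto
  thus ?thesis unfolding emb_def by simp
qed

lemma inj_on_image_edges:
  assumes "inj_on f (verts G)"
  shows "inj_on ((`) f) (edges G)"
  by (rule inj_on_subset[OF inj_on_image_Pow[OF assms]]) (use edge_subset in blast)

lemma img_in_copies:
  assumes "f \<in> emb n" shows "img f \<in> copies n"
proof -
  have f: "inj_on f (verts G)" "f ` verts G \<subseteq> {..<n}"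
    using assms by (auto simp: emb_def)
  have E: "e \<in> (`) f ` edges G \<Longrightarrow> e \<subseteq> f ` verts G \<and> card e = 2" for e
    using edge_subset card_edge f by (auto simp: card_image inj_on_subset image_mono)
  have "simple_graph (img f)"
    using E finite_verts by (auto simp: simple_graph_def img_def)
  hence "subgraph (img f) (complete_graph n)"
    unfolding subgraph_def edges_complete_graph verts_complete_graph
  proof (intro conjI subsetI CollectI)
    fix x assume "x \<in> verts (img f)"
    thus "x \<in> {..<n}" using f(2) by (auto simp: img_def)
  next
    fix e assume "e \<in> edges (img f)"
    hence "e \<subseteq> f ` verts G \<and> card e = 2" by (intro E) (simp add: img_def)
    thus "\<And>x. x \<in> e \<Longrightarrow> x \<in> {..<n}" "card e = 2" using f(2) by blast+
  qed
  moreover have "graph_iso (img f) G"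
    unfolding graph_iso_def
  proof (intro exI conjI ballI)
    show "bij_betw (the_inv_into (verts G) f) (verts (img f)) (verts G)"
      using f(1) by (simp add: img_def bij_betw_the_inv_into inj_on_imp_bij_betw)
    fix x y assume "x \<in> verts (img f)" "y \<in> verts (img f)"
    then obtain a b where ab: "a \<in> verts G" "b \<in> verts G" "x = f a" "y = f b"
      by (auto simp: img_def)
    have "{f a, f b} \<in> (`) f ` edges G \<longleftrightarrow> {a, b} \<in> edges G"
    proof
      assume "{f a, f b} \<in> (`) f ` edges G"
      then obtain e where e: "e \<in> edges G" "f ` {a, b} = f ` e" by auto
      hence "{a, b} = e"
        using inj_on_image_eq_iff[OF f(1), of "{a, b}" e] ab edge_subset by blast
      thus "{a, b} \<in> edges G" using e by simp
    next
      assume "{a, b} \<in> edges G"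
      hence "f ` {a, b} \<in> (`) f ` edges G" by (rule imageI)
      thus "{f a, f b} \<in> (`) f ` edges G" by simp
    qed
    thus "{x, y} \<in> edges (img f) \<longleftrightarrow> {the_inv_into (verts G) f x, the_inv_into (verts G) f y} \<in> edges G"
      using ab f(1) by (simp add: img_def the_inv_into_f_f)
  qed
  ultimately show ?thesis by (simp add: copies_def)
qed

text \<open>The inverse of an isomorphism from a copy onto G, restricted to the vertices of G, is an
  embedding with that image. Copies can thus be counted through functions.\<close>

lemma copies_eq: "copies n = img ` emb n"
proof
  show "img ` emb n \<subseteq> copies n" using img_in_copies by blast
  show "copies n \<subseteq> img ` emb n"
  proof
    fix H assume "H \<in> copies n"
    hence H: "simple_graph H" "verts H \<subseteq> {..<n}" and "graph_iso H G"
      by (auto simp: copies_def subgraph_def verts_complete_graph)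
    then obtain g where g: "bij_betw g (verts H) (verts G)"
      and g_edge: "\<And>u v. u \<in> verts H \<Longrightarrow> v \<in> verts H \<Longrightarrow> {u, v} \<in> edges H \<longleftrightarrow> {g u, g v} \<in> edges G"
      unfolding graph_iso_def by blast
    define f where "f = restrict (the_inv_into (verts H) g) (verts G)"
    have bij: "bij_betw (the_inv_into (verts H) g) (verts G) (verts H)"
      using g by (rule bij_betw_the_inv_into)
    have f_bij: "bij_betw f (verts G) (verts H)"
      using bij by (rule bij_betw_cong[THEN iffD1, rotated]) (simp add: f_def)
    have fg: "f (g u) = u" if "u \<in> verts H" for u
      using that g by (auto simp: f_def bij_betw_def the_inv_into_f_f)
    have "f \<in> emb n"
      using f_bij H(2) by (auto simp: emb_def f_def bij_betw_def)
    moreover have "(`) f ` edges G = edges H"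
    proof (intro equalityI subsetI)
      fix e assume "e \<in> (`) f ` edges G"
      then obtain e' where e': "e' \<in> edges G" "e = f ` e'" by blast
      obtain a b where ab: "e' = {a, b}" using card_edge[OF e'(1)] by (auto simp: card_2_iff)
      have "a \<in> verts G" "b \<in> verts G" using edge_subset[OF e'(1)] ab by auto
      then obtain u v where uv: "u \<in> verts H" "v \<in> verts H" "a = g u" "b = g v"
        using bij_betw_imp_surj_on[OF g] by blast
      have "{u, v} \<in> edges H" using g_edge[OF uv(1,2)] e'(1) ab uv by simp
      thus "e \<in> edges H" using e' ab uv fg by simp
    next
      fix e assume e: "e \<in> edges H"
      then obtain u v where uv: "e = {u, v}" using H(1) by (auto simp: simple_graph_def card_2_iff)
      have uvH: "u \<in> verts H" "v \<in> verts H" using e uv H(1) by (auto simp: simple_graph_def)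
      have "{g u, g v} \<in> edges G" using g_edge[OF uvH] e uv by simp
      moreover have "e = f ` {g u, g v}" using uv uvH fg by simp
      ultimately show "e \<in> (`) f ` edges G" by blast
    qed
    hence "H = img f"
      using f_bij by (cases H) (simp add: img_def bij_betw_def)
    ultimately show "H \<in> img ` emb n" by blast
  qed
qed

lemma finite_copies: "finite (copies n)"
  by (simp add: copies_eq finite_emb)

lemma edges_img [simp]: "edges (img f) = (`) f ` edges G"
  and verts_img [simp]: "verts (img f) = f ` verts G"
  by (simp_all add: img_def)

lemma card_edges_img: "f \<in> emb n \<Longrightarrow> card (edges (img f)) = card (edges G)"
  by (simp add: card_image inj_on_image_edges emb_def)

lemma card_edges_copies: "H \<in> copies n \<Longrightarrow> card (edges H) = card (edges G)"
  by (auto simp: copies_eq card_edges_img simp del: edges_img)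

lemma edges_copies: "H \<in> copies n \<Longrightarrow> edges H \<subseteq> edges (complete_graph n)"
  by (simp add: copies_def subgraph_def)

section \<open>Sums over copies versus sums over embeddings\<close>

lemma sum_copies_le:
  fixes w :: "nat ugraph \<Rightarrow> real"
  assumes "\<And>H. 0 \<le> w H"
  shows "(\<Sum>H\<in>copies n. w H) \<le> (\<Sum>f\<in>emb n. w (img f))"
  unfolding copies_eq using sum_image_le[where g = w and f = img, OF finite_emb] assms by (simp add: o_def)

text \<open>Embeddings with the same image H are maps into the vertices of H, so at most v^v of them
  exist. This crude bound on the number of automorphisms suffices, since only constants depending on
  G are at stake.\<close>

lemma sum_emb_le:
  fixes w :: "nat ugraph \<Rightarrow> real"
  assumes "\<And>H. H \<in> copies n \<Longrightarrow> 0 \<le> w H"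
  shows "(\<Sum>f\<in>emb n. w (img f)) \<le> real (card (verts G)) ^ card (verts G) * (\<Sum>H\<in>copies n. w H)"
proof -
  let ?v = "card (verts G)"
  have "(\<Sum>f\<in>emb n. w (img f)) = (\<Sum>H\<in>copies n. \<Sum>f\<in>{f \<in> emb n. img f = H}. w (img f))"
    by (rule sum.group[symmetric]) (use finite_emb finite_copies img_in_copies in auto)
  also have "\<dots> = (\<Sum>H\<in>copies n. real (card {f \<in> emb n. img f = H}) * w H)"
    by (intro sum.cong refl) simp
  also have "\<dots> \<le> (\<Sum>H\<in>copies n. real ?v ^ ?v * w H)"
  proof (intro sum_mono mult_right_mono assms)
    fix H assume "H \<in> copies n"
    then obtain h where h: "h \<in> emb n" "H = img h" by (auto simp: copies_eq)
    have vH: "card (verts H) = ?v" using h by (simp add: card_image emb_def)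
    have finH: "finite (verts H)" using h finite_verts by simp
    have "card {f \<in> emb n. img f = H} \<le> card (verts G \<rightarrow>\<^sub>E verts H)"
      by (rule card_mono) (auto simp: emb_def finite_verts finH intro!: finite_PiE)
    also have "\<dots> = ?v ^ ?v" by (simp add: card_PiE finite_verts vH)
    finally show "real (card {f \<in> emb n. img f = H}) \<le> real ?v ^ ?v"
      by (metis of_nat_le_iff of_nat_power)
  qed
  finally show ?thesis by (simp only: sum_distrib_left)
qed

section \<open>The minimal subgraph weight\<close>

lemma finite_edges_G: "finite (edges G)"
  by (rule finite_edges[OF simple])

lemma edges_nonempty: "edges G \<noteq> {}"
  using nonempty no_isolated by (auto simp: no_isolated_vertices_def)

lemma card_edges_pos: "0 < card (edges G)"
  using edges_nonempty finite_edges_G by (simp add: card_gt_0_iff)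

lemma card_verts_pos: "0 < card (verts G)"
  using nonempty finite_verts by (simp add: card_gt_0_iff)

lemma finite_subgraphs: "finite {H. subgraph H G}"
proof (rule finite_subset)
  show "{H. subgraph H G} \<subseteq> (\<lambda>(V, F). UGraph V F) ` (Pow (verts G) \<times> Pow (edges G))"
  proof
    fix H assume "H \<in> {H. subgraph H G}"
    hence "H = UGraph (verts H) (edges H)" "verts H \<subseteq> verts G" "edges H \<subseteq> edges G"
      by (auto simp: subgraph_def)
    thus "H \<in> (\<lambda>(V, F). UGraph V F) ` (Pow (verts G) \<times> Pow (edges G))"
      by (metis (no_types, lifting) Pow_iff SigmaI case_prod_conv image_eqI)
  qed
  show "finite ((\<lambda>(V, F). UGraph V F) ` (Pow (verts G) \<times> Pow (edges G)))"
    using finite_verts finite_edges_G by simp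
qed

lemma subgraph_refl: "subgraph G G"
  by (simp add: subgraph_def simple)

lemma min_subgraph_weight_le:
  assumes "subgraph H G" "card (edges H) \<ge> 1"
  shows "min_subgraph_weight G n p \<le> real n ^ card (verts H) * p ^ card (edges H)"
  unfolding min_subgraph_weight_def
  by (rule Min_le) (use finite_subgraphs assms in auto)

lemma min_subgraph_weight_attained:
  obtains H where "subgraph H G" "card (edges H) \<ge> 1"
    "min_subgraph_weight G n p = real n ^ card (verts H) * p ^ card (edges H)"
proof -
  have "min_subgraph_weight G n p \<in>
      {real n ^ card (verts H) * p ^ card (edges H) | H. subgraph H G \<and> card (edges H) \<ge> 1}"
    unfolding min_subgraph_weight_def
  proof (rule Min_in)
    show "finite {real n ^ card (verts H) * p ^ card (edges H) | H. subgraph H G \<and> card (edges H) \<ge> 1}"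
      using finite_subgraphs by auto
    show "{real n ^ card (verts H) * p ^ card (edges H) | H. subgraph H G \<and> card (edges H) \<ge> 1} \<noteq> {}"
      using subgraph_refl card_edges_pos by (auto simp: Suc_le_eq)
  qed
  thus ?thesis using that by blast
qed

lemma min_subgraph_weight_pos: "n \<ge> 1 \<Longrightarrow> 0 < p \<Longrightarrow> 0 < min_subgraph_weight G n p"
  by (rule min_subgraph_weight_attained[of n p]) auto

section \<open>Copies meeting a given edge set\<close>

lemma card_Union_edges_le:
  assumes "finite U" "\<And>e. e \<in> U \<Longrightarrow> card e = (2::nat)"
  shows "card (\<Union>U) \<le> 2 * card U"
proof -
  have "card (\<Union>U) \<le> (\<Sum>e\<in>U. card e)" by (rule card_Union_le_sum_card)
  also have "\<dots> = 2 * card U" using assms(2) by simp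
  finally show ?thesis .
qed

text \<open>Embeddings are sorted by the nonempty set A of edges of G that they send into U; there
  are at most 2^e such sets. The k vertices covered by A must land among the at most 6 e vertices of
  U (3 e edges, two ends each), the other v - k are free, and e - |A| edges are new. The
  contribution of A is thus of order n^v p^e divided by n^k p^|A|, the weight of the subgraph formed
  by A, which is at least the minimal weight.\<close>

lemma sum_emb_meeting_le:
  assumes n: "n \<ge> 1" and p: "0 < p" and U: "U \<subseteq> edges (complete_graph n)" "card U \<le> 3 * card (edges G)"
  shows "(\<Sum>f\<in>emb n. of_bool (edges (img f) \<inter> U \<noteq> {}) * p ^ card (edges (img f) - U)) \<le>
    2 ^ card (edges G) * (6 * card (edges G)) ^ card (verts G) *
    (real n ^ card (verts G) * p ^ card (edges G) / min_subgraph_weight G n p)"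
proof -
  let ?v = "card (verts G)" and ?e = "card (edges G)"
  define B where "B = real n ^ ?v * p ^ ?e"
  define Psi where "Psi = min_subgraph_weight G n p"
  have Psi: "0 < Psi" unfolding Psi_def using n p by (rule min_subgraph_weight_pos)
  define h where "h f = {e \<in> edges G. f ` e \<in> U}" for f :: "'a \<Rightarrow> nat"
  let ?D = "Pow (edges G) - {{}}"
  have finU: "finite U" by (rule finite_subset[OF U(1) finite_edges_complete_graph])
  have finUU: "finite (\<Union>U)"
    by (rule finite_subset[of _ "{..<n}"]) (use U(1) in \<open>auto simp: edges_complete_graph\<close>)
  have cardUU: "card (\<Union>U) \<le> 6 * ?e"
    using card_Union_edges_le[of U] finU U by (fastforce simp: edges_complete_graph)
  have weight_eq: "of_bool (edges (img f) \<inter> U \<noteq> {}) * p ^ card (edges (img f) - U) =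
      (\<Sum>A\<in>?D. of_bool (h f = A) * p ^ (?e - card A))" if f: "f \<in> emb n" for f
  proof -
    have inj: "inj_on ((`) f) (edges G)" using f by (auto simp: emb_def intro: inj_on_image_edges)
    have hf: "h f \<subseteq> edges G" by (auto simp: h_def)
    have iff: "edges (img f) \<inter> U \<noteq> {} \<longleftrightarrow> h f \<in> ?D" by (auto simp: h_def)
    have "edges (img f) - U = (`) f ` (edges G - h f)" by (auto simp: h_def)
    hence "card (edges (img f) - U) = card (edges G - h f)"
      using inj by (simp add: card_image inj_on_subset)
    also have "\<dots> = ?e - card (h f)"
      by (rule card_Diff_subset) (use hf finite_edges_G finite_subset in auto)
    finally have c: "card (edges (img f) - U) = ?e - card (h f)" .
    have "(\<Sum>A\<in>?D. of_bool (h f = A) * p ^ (?e - card A)) = (\<Sum>A\<in>?D. if h f = A then p ^ (?e - card A) else 0)"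
      by (intro sum.cong) auto
    also have "\<dots> = (if h f \<in> ?D then p ^ (?e - card (h f)) else 0)"
      using finite_edges_G by (subst sum.delta') auto
    finally show ?thesis unfolding c iff by simp
  qed
  have count: "(\<Sum>f\<in>emb n. of_bool (h f = A) * p ^ (?e - card A)) \<le> (6 * ?e) ^ ?v * (B / Psi)"
    if A: "A \<in> ?D" for A
  proof -
    have AG: "A \<subseteq> edges G" "A \<noteq> {}" "finite A"
      using A finite_edges_G by (auto intro: finite_subset)
    have UA: "\<Union>A \<subseteq> verts G" using AG edge_subset by blast
    define k where "k = card (\<Union>A)"
    have k: "k \<le> ?v" unfolding k_def by (rule card_mono[OF finite_verts UA])
    have cA: "card A \<le> ?e" by (rule card_mono[OF finite_edges_G AG(1)])
    have sub: "subgraph (UGraph (\<Union>A) A) G"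
      using UA AG finite_verts card_edge by (auto simp: subgraph_def simple_graph_def intro: finite_subset)
    have "card A \<ge> 1" using AG by (simp add: Suc_le_eq card_gt_0_iff)
    hence PsiA: "Psi \<le> real n ^ k * p ^ card A"
      using min_subgraph_weight_le[OF sub, of n p] by (simp add: Psi_def k_def)
    have "card {f \<in> emb n. h f = A} \<le> card (\<Pi>\<^sub>E x\<in>verts G. if x \<in> \<Union>A then \<Union>U else {..<n})"
    proof (rule card_mono)
      show "finite (\<Pi>\<^sub>E x\<in>verts G. if x \<in> \<Union>A then \<Union>U else {..<n})"
        using finite_verts finUU by (intro finite_PiE) auto
      show "{f \<in> emb n. h f = A} \<subseteq> (\<Pi>\<^sub>E x\<in>verts G. if x \<in> \<Union>A then \<Union>U else {..<n})"
      proof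
        fix f assume "f \<in> {f \<in> emb n. h f = A}"
        hence f: "f \<in> verts G \<rightarrow>\<^sub>E {..<n}" "h f = A" by (auto simp: emb_def)
        have "f x \<in> \<Union>U" if "x \<in> \<Union>A" for x
          using that f(2) by (auto simp: h_def)
        thus "f \<in> (\<Pi>\<^sub>E x\<in>verts G. if x \<in> \<Union>A then \<Union>U else {..<n})"
          using f(1) by (auto simp: PiE_iff)
      qed
    qed
    also have "\<dots> = (\<Prod>x\<in>verts G. if x \<in> \<Union>A then card (\<Union>U) else n)"
      by (subst card_PiE[OF finite_verts]) (auto intro!: prod.cong)
    also have "\<dots> = card (\<Union>U) ^ card (verts G \<inter> \<Union>A) * n ^ card (verts G \<inter> - \<Union>A)"
      by (subst prod.If_cases[OF finite_verts]) (simp add: Int_def)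
    also have "verts G \<inter> \<Union>A = \<Union>A" using UA by blast
    also have "card (verts G \<inter> - \<Union>A) = ?v - k"
      unfolding k_def using UA finite_verts by (simp add: Diff_eq[symmetric] card_Diff_subset finite_subset)
    also have "card (\<Union>U) ^ card (\<Union>A) \<le> (6 * ?e) ^ k"
      unfolding k_def by (rule power_mono[OF cardUU]) simp
    also have "(6 * ?e) ^ k \<le> (6 * ?e) ^ ?v"
      by (rule power_increasing[OF k]) (use card_edges_pos in simp)
    finally have "card {f \<in> emb n. h f = A} \<le> (6 * ?e) ^ ?v * n ^ (?v - k)"
      by simp
    from of_nat_mono[OF this, where 'a = real]
    have c: "real (card {f \<in> emb n. h f = A}) \<le> (6 * ?e) ^ ?v * real n ^ (?v - k)"
      by simp
    have "(\<Sum>f\<in>emb n. of_bool (h f = A) * p ^ (?e - card A)) = real (card {f \<in> emb n. h f = A}) * p ^ (?e - card A)"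
      using finite_emb by (simp add: sum_distrib_right[symmetric] of_bool_def sum.If_cases Int_def)
    also have "\<dots> \<le> (6 * ?e) ^ ?v * real n ^ (?v - k) * p ^ (?e - card A)"
      using c p by (intro mult_right_mono) auto
    also have "\<dots> = (6 * ?e) ^ ?v * (B / (real n ^ k * p ^ card A))"
      using n p k cA by (simp add: B_def power_diff)
    also have "\<dots> \<le> (6 * ?e) ^ ?v * (B / Psi)"
      using PsiA Psi n p by (intro mult_left_mono divide_left_mono) (auto simp: B_def)
    finally show ?thesis .
  qed
  have "(\<Sum>f\<in>emb n. of_bool (edges (img f) \<inter> U \<noteq> {}) * p ^ card (edges (img f) - U)) =
      (\<Sum>A\<in>?D. \<Sum>f\<in>emb n. of_bool (h f = A) * p ^ (?e - card A))"
    by (subst sum.swap) (intro sum.cong refl weight_eq)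
  also have "\<dots> \<le> (\<Sum>A\<in>?D. (6 * ?e) ^ ?v * (B / Psi))"
    by (rule sum_mono) (rule count)
  also have "\<dots> = real (card ?D) * ((6 * ?e) ^ ?v * (B / Psi))"
    by simp
  also have "\<dots> \<le> 2 ^ ?e * ((6 * ?e) ^ ?v * (B / Psi))"
  proof (rule mult_right_mono)
    have "card ?D \<le> card (Pow (edges G))"
      using finite_edges_G by (intro card_mono) auto
    from of_nat_mono[OF this, where 'a = real] show "real (card ?D) \<le> 2 ^ ?e"
      using finite_edges_G by (simp add: card_Pow del: card_Diff_insert)
    show "0 \<le> (6 * ?e) ^ ?v * (B / Psi)" using Psi p by (simp add: B_def)
  qed
  finally show ?thesis by (simp add: B_def Psi_def mult_ac)
qed

lemma sum_copies_meeting_le: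
  assumes "n \<ge> 1" "0 < p" "U \<subseteq> edges (complete_graph n)" "card U \<le> 3 * card (edges G)"
  shows "(\<Sum>H\<in>copies n. of_bool (edges H \<inter> U \<noteq> {}) * p ^ card (edges H - U)) \<le>
    2 ^ card (edges G) * (6 * card (edges G)) ^ card (verts G) *
    (real n ^ card (verts G) * p ^ card (edges G) / min_subgraph_weight G n p)"
  by (rule order.trans[OF sum_copies_le sum_emb_meeting_le[OF assms]]) (use assms in simp)

section \<open>The number of embeddings\<close>

lemma card_emb_le: "card (emb n) \<le> n ^ card (verts G)"
proof -
  have "card (emb n) \<le> card (verts G \<rightarrow>\<^sub>E {..<n})"
    by (rule card_mono) (auto simp: emb_def finite_verts intro!: finite_PiE)
  thus ?thesis by (simp add: card_PiE finite_verts)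
qed

lemma sum_copies_power_le:
  assumes "0 < p"
  shows "(\<Sum>H\<in>copies n. p ^ card (edges H)) \<le> real n ^ card (verts G) * p ^ card (edges G)"
proof -
  have "(\<Sum>H\<in>copies n. p ^ card (edges H)) \<le> (\<Sum>f\<in>emb n. p ^ card (edges (img f)))"
    by (rule sum_copies_le) (use assms in simp)
  also have "\<dots> = real (card (emb n)) * p ^ card (edges G)"
    by (simp add: card_edges_img del: edges_img)
  also have "\<dots> \<le> real n ^ card (verts G) * p ^ card (edges G)"
    using card_emb_le[of n] assms by (intro mult_right_mono) (auto simp flip: of_nat_power)
  finally show ?thesis .
qed

lemma card_emb_ge:
  assumes "card (verts G) \<le> n"
  shows "(real n / (2 * card (verts G))) ^ card (verts G) \<le> real (card (emb n))"
proof -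
  let ?v = "card (verts G)"
  \<comment> \<open>Maps sending distinct vertices to distinct blocks of length \<open>b\<close> are injective.\<close>
  define b where "b = n div ?v"
  obtain idx where idx: "bij_betw idx (verts G) {0..<?v}"
    using ex_bij_betw_finite_nat[OF finite_verts] by blast
  have idx_less: "idx x < ?v" if "x \<in> verts G" for x
    using idx that by (auto simp: bij_betw_def)
  have b: "b * ?v \<le> n" by (simp add: b_def)
  \<comment> \<open>Rounding down loses at most a factor 2: because n \<ge> v, the block length b is
    at least 1, so the remainder is smaller than b v.\<close>
  have "real n \<le> 2 * (b * ?v)"
  proof -
    have "n = b * ?v + n mod ?v" by (simp add: b_def)
    moreover have "n mod ?v < ?v" using card_verts_pos by simp
    moreover have "?v \<le> b * ?v" using assms card_verts_pos by (simp add: b_def Suc_le_eq div_greater_zero_iff)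
    ultimately have "n \<le> 2 * (b * ?v)" by linarith
    from of_nat_mono[OF this, where 'a = real] show ?thesis by simp
  qed
  hence "(real n / (2 * ?v)) ^ ?v \<le> real b ^ ?v"
    using card_verts_pos by (intro power_mono) (auto simp: field_simps)
  also have "\<dots> = real (card (\<Pi>\<^sub>E x\<in>verts G. {b * idx x..<b * idx x + b}))"
    by (simp add: card_PiE finite_verts)
  also have "\<dots> \<le> real (card (emb n))"
  proof (intro of_nat_mono card_mono finite_emb subsetI)
    fix f assume f: "f \<in> (\<Pi>\<^sub>E x\<in>verts G. {b * idx x..<b * idx x + b})"
    have fx: "b * idx x \<le> f x" "f x < b * idx x + b" if "x \<in> verts G" for x
      using f that by (auto simp: PiE_iff)
    have "f x < n" if "x \<in> verts G" for x
    proof -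
      have "f x < b * (idx x + 1)" using fx[OF that] by simp
      also have "\<dots> \<le> b * ?v" using idx_less[OF that] by (intro mult_le_mono) auto
      finally show ?thesis using b by simp
    qed
    moreover have "inj_on f (verts G)"
    proof (rule inj_onI)
      fix x y assume xy: "x \<in> verts G" "y \<in> verts G" "f x = f y"
      have *: "idx x \<le> idx y" if "x \<in> verts G" "y \<in> verts G" "f x = f y" for x y
      proof (rule ccontr)
        assume "\<not> idx x \<le> idx y"
        hence "b * (idx y + 1) \<le> b * idx x" by (intro mult_le_mono) auto
        thus False using fx[OF that(1)] fx[OF that(2)] that(3) by simp
      qed
      have "idx x = idx y" using *[OF xy] *[OF xy(2,1) xy(3)[symmetric]] by simp
      thus "x = y" using idx xy by (auto simp: bij_betw_def dest: inj_onD)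
    qed
    ultimately show "f \<in> emb n" using f by (auto simp: emb_def PiE_iff)
  qed
  finally show ?thesis .
qed

section \<open>The variance of the subgraph count and the rate\<close>

text \<open>Cauchy-Schwarz over the classes of embeddings with the same restriction to
  \<open>V0\<close>; there are at most n^|V0| classes.\<close>

lemma agreeing_pairs_ge:
  assumes V0: "V0 \<subseteq> verts G"
  shows "(real (card (emb n)))\<^sup>2 \<le> real n ^ card V0 *
    (\<Sum>f\<in>emb n. \<Sum>g\<in>emb n. of_bool (restrict f V0 = restrict g V0))"
proof -
  let ?Y = "V0 \<rightarrow>\<^sub>E {..<n}"
  define c where "c y = (\<Sum>f\<in>emb n. of_bool (restrict f V0 = y) :: real)" for y
  have fin: "finite V0" using V0 finite_verts finite_subset by blast
  have finY: "finite ?Y" using fin by (intro finite_PiE) auto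
  have res: "restrict f V0 \<in> ?Y" if "f \<in> emb n" for f
    using that V0 by (auto simp: emb_def PiE_iff)
  have one: "(\<Sum>y\<in>?Y. of_bool (restrict f V0 = y) * h y) = h (restrict f V0)" if "f \<in> emb n" for f and h :: "_ \<Rightarrow> real"
  proof -
    have "(\<Sum>y\<in>?Y. of_bool (restrict f V0 = y) * h y) = (\<Sum>y\<in>?Y. if restrict f V0 = y then h y else 0)"
      by (intro sum.cong) auto
    thus ?thesis using sum.delta'[OF finY, of "restrict f V0" h] res[OF that] by simp
  qed
  have "(\<Sum>y\<in>?Y. c y) = (\<Sum>f\<in>emb n. \<Sum>y\<in>?Y. of_bool (restrict f V0 = y))"
    unfolding c_def by (rule sum.swap)
  also have "\<dots> = (\<Sum>f\<in>emb n. 1)"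
    by (rule sum.cong[OF refl]) (use one[of _ "\<lambda>_. 1"] in simp)
  finally have sum_c: "(\<Sum>y\<in>?Y. c y) = real (card (emb n))" by simp
  have "(\<Sum>y\<in>?Y. (c y)\<^sup>2) = (\<Sum>y\<in>?Y. \<Sum>f\<in>emb n. of_bool (restrict f V0 = y) * c y)"
    by (simp only: power2_eq_square sum_distrib_right[symmetric] c_def[symmetric])
  also have "\<dots> = (\<Sum>f\<in>emb n. c (restrict f V0))"
    by (subst sum.swap) (simp only: one cong: sum.cong)
  also have "\<dots> = (\<Sum>f\<in>emb n. \<Sum>g\<in>emb n. of_bool (restrict f V0 = restrict g V0))"
    by (simp only: c_def eq_commute)
  finally have sum_c2: "(\<Sum>y\<in>?Y. (c y)\<^sup>2) = \<dots>" .
  have "(\<Sum>y\<in>?Y. c y)\<^sup>2 \<le> (\<Sum>y\<in>?Y. (c y)\<^sup>2) * card ?Y"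
    by (rule sum_squared_le_sum_of_squares)
  thus ?thesis unfolding sum_c sum_c2 using fin by (simp add: card_PiE mult.commute)
qed

text \<open>The double sum is the variance of the count, and all its terms are nonnegative, so it
  may be restricted to pairs of embeddings agreeing on the vertices of \<open>H0\<close>. Such pairs
  are numerous by \<open>agreeing_pairs_ge\<close>. In the constant, v^v pays for passing from
  copies to embeddings and (2 v)^v for \<open>card_emb_ge\<close>; both are squared because pairs
  are counted.\<close>

lemma variance_lower_bound:
  assumes n: "card (verts G) \<le> n" and p: "0 < p" "p < 1" and H0: "subgraph H0 G" "card (edges H0) \<ge> 1"
  shows "(1 - p) * (real n ^ card (verts G) * p ^ card (edges G))\<^sup>2 / (real n ^ card (verts H0) * p ^ card (edges H0)) \<le>
    (real (card (verts G)) ^ card (verts G) * (2 * real (card (verts G))) ^ card (verts G))\<^sup>2 *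
    (\<Sum>H\<in>copies n. \<Sum>H'\<in>copies n. p ^ card (edges H \<union> edges H') - p ^ (card (edges H) + card (edges H')))"
proof -
  let ?v = "card (verts G)" and ?e = "card (edges G)"
  define V0 k where "V0 = verts H0" and "k = card (edges H0)"
  define t where "t F F' = p ^ card (F \<union> F') - p ^ (card F + card F')" for F F' :: "nat set set"
  have H0': "V0 \<subseteq> verts G" "edges H0 \<subseteq> edges G" "\<And>e. e \<in> edges H0 \<Longrightarrow> e \<subseteq> V0"
    using H0 by (auto simp: subgraph_def simple_graph_def V0_def)
  have t_nonneg: "0 \<le> t F F'" for F F'
    unfolding t_def using p card_Un_le[of F F'] by (simp add: power_decreasing)
  have n0: "0 < n" using n card_verts_pos by linarith
  define s2 where "s2 = (\<Sum>H\<in>copies n. \<Sum>H'\<in>copies n. t (edges H) (edges H'))"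
  have pair: "(1 - p) * p ^ (2 * ?e - k) * of_bool (restrict f V0 = restrict g V0) \<le> t (edges (img f)) (edges (img g))"
    if f: "f \<in> emb n" and g: "g \<in> emb n" for f g
  proof (cases "restrict f V0 = restrict g V0")
    case True
    let ?F = "edges (img f)" and ?F' = "edges (img g)"
    have eq: "f ` e = g ` e" if "e \<in> edges H0" for e
      using H0'(3)[OF that] True by (intro image_cong refl) (metis restrict_apply' subsetD)
    have sub: "(`) f ` edges H0 \<subseteq> ?F \<inter> ?F'"
    proof (rule image_subsetI)
      fix e assume e: "e \<in> edges H0"
      hence "e \<in> edges G" using H0'(2) by blast
      hence "f ` e \<in> ?F" "g ` e \<in> ?F'" by simp_all
      thus "f ` e \<in> ?F \<inter> ?F'" using eq[OF e] by simp
    qed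
    have fin: "finite ?F" "finite ?F'" using finite_edges_G by simp_all
    have "card ((`) f ` edges H0) = k"
      unfolding k_def using f H0'(2)
      by (intro card_image inj_on_subset[OF inj_on_image_edges]) (auto simp: emb_def)
    hence kle: "k \<le> card (?F \<inter> ?F')"
      using card_mono[OF _ sub] fin by simp
    have cards: "card ?F = ?e" "card ?F' = ?e" using card_edges_img f g by auto
    have un: "card (?F \<union> ?F') + card (?F \<inter> ?F') = 2 * ?e"
      using card_Un_Int[OF fin] cards by simp
    have "t ?F ?F' = p ^ card (?F \<union> ?F') * (1 - p ^ card (?F \<inter> ?F'))"
    proof -
      have "card ?F + card ?F' = card (?F \<union> ?F') + card (?F \<inter> ?F')"
        by (rule card_Un_Int[OF fin])
      thus ?thesis unfolding t_def by (simp only: power_add right_diff_distrib mult_1_right)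
    qed
    \<comment> \<open>The two images share at least k edges, so their union has at most 2 e - k; as
      k \<ge> 1, the second factor is at least 1 - p.\<close>
    moreover have "p ^ (2 * ?e - k) * (1 - p) \<le> p ^ card (?F \<union> ?F') * (1 - p ^ card (?F \<inter> ?F'))"
    proof (rule mult_mono)
      show "p ^ (2 * ?e - k) \<le> p ^ card (?F \<union> ?F')"
        using p kle un by (intro power_decreasing) auto
      have "p ^ card (?F \<inter> ?F') \<le> p ^ 1"
        using p kle H0(2) by (intro power_decreasing) (auto simp: k_def)
      thus "1 - p \<le> 1 - p ^ card (?F \<inter> ?F')" by simp
    qed (use p in auto)
    ultimately show ?thesis using True by (simp add: mult.commute)
  qed (use t_nonneg in simp)
  have "(\<Sum>f\<in>emb n. \<Sum>g\<in>emb n. t (edges (img f)) (edges (img g)))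
      \<le> (\<Sum>f\<in>emb n. real ?v ^ ?v * (\<Sum>H'\<in>copies n. t (edges (img f)) (edges H')))"
    by (intro sum_mono sum_emb_le[where w = "\<lambda>H'. t (edges (img _)) (edges H')"] t_nonneg)
  also have "\<dots> = real ?v ^ ?v * (\<Sum>f\<in>emb n. \<Sum>H'\<in>copies n. t (edges (img f)) (edges H'))"
    by (simp only: sum_distrib_left)
  also have "\<dots> \<le> real ?v ^ ?v * (real ?v ^ ?v * s2)"
    unfolding s2_def
    by (intro mult_left_mono sum_emb_le[where w = "\<lambda>H. \<Sum>H'\<in>copies n. t (edges H) (edges H')"] sum_nonneg t_nonneg) auto
  finally have up: "(\<Sum>f\<in>emb n. \<Sum>g\<in>emb n. t (edges (img f)) (edges (img g))) \<le> (real ?v ^ ?v)\<^sup>2 * s2"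
    by (simp add: power2_eq_square mult.assoc)
  define Pr where "Pr = (\<Sum>f\<in>emb n. \<Sum>g\<in>emb n. of_bool (restrict f V0 = restrict g V0) :: real)"
  have lo: "(1 - p) * p ^ (2 * ?e - k) * Pr \<le> (\<Sum>f\<in>emb n. \<Sum>g\<in>emb n. t (edges (img f)) (edges (img g)))"
    unfolding Pr_def sum_distrib_left by (intro sum_mono pair)
  have "((real n / (2 * ?v)) ^ ?v)\<^sup>2 \<le> (real (card (emb n)))\<^sup>2"
    using card_emb_ge[OF n] by (intro power_mono) auto
  also have "\<dots> \<le> real n ^ card V0 * Pr"
    unfolding Pr_def by (rule agreeing_pairs_ge[OF H0'(1)])
  finally have "(real n ^ ?v)\<^sup>2 \<le> ((2 * real ?v) ^ ?v)\<^sup>2 * (real n ^ card V0 * Pr)"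
    using card_verts_pos by (simp add: power_divide divide_le_eq mult.commute)
  hence Pr: "(real n ^ ?v)\<^sup>2 / real n ^ card V0 \<le> ((2 * real ?v) ^ ?v)\<^sup>2 * Pr"
    using n0 by (simp add: divide_le_eq mult_ac)
  have kE: "k \<le> 2 * ?e"
    using card_mono[OF finite_edges_G H0'(2)] by (simp add: k_def)
  have "(1 - p) * (real n ^ ?v * p ^ ?e)\<^sup>2 / (real n ^ card V0 * p ^ k) =
      (1 - p) * p ^ (2 * ?e - k) * ((real n ^ ?v)\<^sup>2 / real n ^ card V0)"
    using p kE by (simp add: power_diff power_mult_distrib power_mult[symmetric] mult.commute)
  also have "\<dots> \<le> (1 - p) * p ^ (2 * ?e - k) * (((2 * real ?v) ^ ?v)\<^sup>2 * Pr)"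
    using p by (intro mult_left_mono Pr) auto
  also have "\<dots> = ((2 * real ?v) ^ ?v)\<^sup>2 * ((1 - p) * p ^ (2 * ?e - k) * Pr)"
    by (simp only: mult_ac)
  also have "\<dots> \<le> ((2 * real ?v) ^ ?v)\<^sup>2 * ((real ?v ^ ?v)\<^sup>2 * s2)"
    by (intro mult_left_mono order.trans[OF lo up]) auto
  also have "\<dots> = (real ?v ^ ?v * (2 * real ?v) ^ ?v)\<^sup>2 * s2"
    by (simp only: power_mult_distrib mult_ac)
  finally show ?thesis by (simp only: V0_def k_def s2_def t_def)
qed

section \<open>From edge indicators to the random graph\<close>

definition edge_subset_graph :: "nat \<Rightarrow> (nat set \<Rightarrow> bool) \<Rightarrow> nat ugraph" where
  "edge_subset_graph n x = UGraph (verts (complete_graph n)) {e \<in> edges (complete_graph n). x e}"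

lemma subgraph_count_eq:
  "real (subgraph_count G (edge_subset_graph n x)) = (\<Sum>H\<in>copies n. of_bool (\<forall>e\<in>edges H. x e))"
proof -
  have "{H. subgraph H (edge_subset_graph n x) \<and> graph_iso H G} = {H \<in> copies n. \<forall>e\<in>edges H. x e}"
    by (auto simp: copies_def subgraph_def edge_subset_graph_def)
  thus ?thesis
    using finite_copies by (simp add: subgraph_count_def of_bool_def sum.If_cases Int_def)
qed

lemma cdf_normalized_count_distr:
  fixes n p
  defines "P \<equiv> Pi_pmf (edges (complete_graph n)) False (\<lambda>_. bernoulli_pmf p)"
  defines "N \<equiv> \<lambda>x. real (subgraph_count G (edge_subset_graph n x))"
  shows "cdf (normalized_count_distr G n p) z =
    measure_pmf.prob P {x. (N x - measure_pmf.expectation P N) / sqrt (measure_pmf.variance P N) \<le> z}"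
proof -
  have R: "random_graph n p = map_pmf (edge_subset_graph n) P"
    by (simp add: random_graph_def P_def edge_subset_graph_def[abs_def])
  have "cdf (normalized_count_distr G n p) z = measure_pmf.prob (random_graph n p) {K. normalized_count G n p K \<le> z}"
    unfolding cdf_def normalized_count_distr_def by (subst measure_distr) (auto simp: vimage_def)
  also have "\<dots> = measure_pmf.prob P {x. normalized_count G n p (edge_subset_graph n x) \<le> z}"
    by (simp add: R vimage_def)
  finally show ?thesis by (simp add: normalized_count_def R N_def)
qed

text \<open>Serves the finitely many n below the number of vertices of G, where no copy exists and
  the variance is zero.\<close>

lemma kolmogorov_dist_le_1: "kolmogorov_dist (normalized_count_distr G n p) std_normal_distribution \<le> 1"
  unfolding kolmogorov_dist_def
proof (rule cSUP_least)
  fix z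
  have "0 \<le> cdf (normalized_count_distr G n p) z" "cdf (normalized_count_distr G n p) z \<le> 1"
    by (simp_all add: cdf_normalized_count_distr)
  thus "\<bar>cdf (normalized_count_distr G n p) z - cdf std_normal_distribution z\<bar> \<le> 1"
    using Phi_nonneg[of z] Phi_le_1[of z] by (simp add: Phi_def)
qed simp

lemma kolmogorov_dist_le_large_n:
  fixes n p
  assumes n: "card (verts G) \<le> n" and p: "0 < p" "p < 1"
  defines "v \<equiv> card (verts G)" and "e \<equiv> card (edges G)"
  defines "K \<equiv> real (2 ^ e * (6 * e) ^ v)" and "c \<equiv> (real v ^ v * (2 * real v) ^ v)\<^sup>2"
  shows "kolmogorov_dist (normalized_count_distr G n p) std_normal_distribution
    \<le> 3 * e * sqrt (2 * K ^ 3) * c / sqrt ((1 - p) * min_subgraph_weight G n p)"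
proof -
  interpret bernoulli_field "edges (complete_graph n)" p
    using finite_edges_complete_graph p by unfold_locales
  define Psi B q where "Psi = min_subgraph_weight G n p" and "B = real n ^ v * p ^ e" and "q = 1 - p"
  have n1: "1 \<le> n" using n card_verts_pos by linarith
  have pos: "0 < Psi" "0 < B" "0 < q"
    using min_subgraph_weight_pos[OF n1 p(1)] n1 p by (auto simp: Psi_def B_def q_def)
  define N where "N x = (\<Sum>H\<in>copies n. mon (edges H) x)" for x
  define s2 where "s2 = measure_pmf.variance P N"
  have s2_eq: "s2 = (\<Sum>H\<in>copies n. \<Sum>H'\<in>copies n. p ^ card (edges H \<union> edges H') - p ^ (card (edges H) + card (edges H')))"
    unfolding s2_def N_def by (rule variance_sum_mon[OF edges_copies])
  obtain H0 where H0: "subgraph H0 G" "card (edges H0) \<ge> 1" "Psi = real n ^ card (verts H0) * p ^ card (edges H0)"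
    unfolding Psi_def by (rule min_subgraph_weight_attained)
  have low: "q * B\<^sup>2 / Psi \<le> c * s2"
    using variance_lower_bound[OF n p H0(1,2)]
    by (simp only: s2_eq H0(3) q_def B_def c_def v_def e_def)
  have c_pos: "0 < c" using card_verts_pos by (simp add: c_def v_def)
  have "0 < q * B\<^sup>2 / Psi" using pos by simp
  \<comment> \<open>Nondegeneracy of the count comes for free from the lower bound.\<close>
  hence "0 < c * s2" using low by linarith
  hence s2_pos: "0 < s2" using c_pos by (simp add: zero_less_mult_iff)
  have Q: "linked_sum (copies n) edges \<le> 2 * B * (K * (B / Psi)) ^ 3"
  proof (rule linked_sum_le)
    show "(\<Sum>H\<in>copies n. p ^ card (edges H)) \<le> B"
      unfolding B_def v_def e_def by (rule sum_copies_power_le[OF p(1)])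
    show "(\<Sum>H\<in>copies n. of_bool (edges H \<inter> U \<noteq> {}) * p ^ card (edges H - U)) \<le> K * (B / Psi)"
      if "U \<subseteq> edges (complete_graph n)" "card U \<le> 3 * e" for U
      using sum_copies_meeting_le[OF n1 p(1), of U] that by (simp add: K_def B_def Psi_def v_def e_def)
  qed (use finite_copies edges_copies card_edges_copies in \<open>auto simp: e_def\<close>)
  \<comment> \<open>Power counting: up to constants the linked sum is at most B^4 / Psi^3 and the
    variance at least q B^2 / Psi. All powers of B cancel in the quotient, and (q Psi)^(-1/2)
    remains.\<close>
  have rate: "3 * e * sqrt (q * linked_sum (copies n) edges) / s2 \<le> 3 * e * sqrt (2 * K ^ 3) * c / sqrt (q * Psi)"
  proof -
    have "sqrt (q * linked_sum (copies n) edges) \<le> sqrt (q * (2 * B * (K * (B / Psi)) ^ 3))"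
      using Q pos by (intro real_sqrt_le_mono mult_left_mono) auto
    also have "q * (2 * B * (K * (B / Psi)) ^ 3) = (2 * K ^ 3) * (q * Psi) * (B\<^sup>2 / Psi\<^sup>2)\<^sup>2"
      using pos by (simp add: field_simps power2_eq_square power3_eq_cube)
    also have "sqrt \<dots> = sqrt (2 * K ^ 3) * sqrt (q * Psi) * (B\<^sup>2 / Psi\<^sup>2)"
      by (simp add: real_sqrt_mult)
    finally have 1: "sqrt (q * linked_sum (copies n) edges) \<le> \<dots>" .
    have 2: "1 / s2 \<le> c * Psi / (q * B\<^sup>2)"
      using low pos s2_pos by (simp add: field_simps)
    have "sqrt (q * linked_sum (copies n) edges) / s2 = sqrt (q * linked_sum (copies n) edges) * (1 / s2)" by simp
    also have "\<dots> \<le> (sqrt (2 * K ^ 3) * sqrt (q * Psi) * (B\<^sup>2 / Psi\<^sup>2)) * (c * Psi / (q * B\<^sup>2))"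
      by (rule mult_mono[OF 1 2]) (use s2_pos pos in \<open>auto simp: K_def\<close>)
    also have "\<dots> = sqrt (2 * K ^ 3) * c * (sqrt (q * Psi) / (q * Psi))"
      using pos by (simp add: field_simps power2_eq_square)
    also have "sqrt (q * Psi) / (q * Psi) = 1 / sqrt (q * Psi)"
      using pos by (simp add: sqrt_divide_self_eq inverse_eq_divide)
    finally have "3 * e * (sqrt (q * linked_sum (copies n) edges) / s2) \<le> 3 * e * (sqrt (2 * K ^ 3) * c * (1 / sqrt (q * Psi)))"
      by (rule mult_left_mono) simp
    thus ?thesis by simp
  qed
  have NS: "real (subgraph_count G (edge_subset_graph n x)) = N x" for x
    by (simp add: subgraph_count_eq N_def mon_def)
  have "\<bar>measure_pmf.prob P {x. (N x - Ex N) / sqrt s2 \<le> z} - Phi z\<bar> \<le>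
      real (3 * e) * sqrt ((1 - p) * linked_sum (copies n) edges) / s2" for z
    unfolding s2_def N_def[abs_def]
    by (rule kolmogorov_bound_sum_mon)
       (use finite_copies edges_copies card_edges_copies s2_pos in \<open>simp_all add: e_def s2_def N_def[abs_def]\<close>)
  hence "\<bar>cdf (normalized_count_distr G n p) z - cdf std_normal_distribution z\<bar> \<le>
      3 * e * sqrt (q * linked_sum (copies n) edges) / s2" for z
    unfolding cdf_normalized_count_distr NS P_def[symmetric] s2_def[symmetric] Phi_def[symmetric] q_def .
  hence "\<bar>cdf (normalized_count_distr G n p) z - cdf std_normal_distribution z\<bar> \<le>
      3 * e * sqrt (2 * K ^ 3) * c / sqrt (q * Psi)" for z
    using rate order.trans by blast
  thus ?thesis
    unfolding kolmogorov_dist_def q_def Psi_def by (intro cSUP_least) auto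
qed

theorem kolmogorov_dist_le:
  "\<exists>C>0. \<forall>n\<ge>1. \<forall>p. 0 < p \<longrightarrow> p < 1 \<longrightarrow>
    kolmogorov_dist (normalized_count_distr G n p) std_normal_distribution
      \<le> C / sqrt ((1 - p) * min_subgraph_weight G n p)"
proof -
  let ?v = "card (verts G)" and ?e = "card (edges G)"
  define C1 where "C1 = 3 * ?e * sqrt (2 * (real (2 ^ ?e * (6 * ?e) ^ ?v)) ^ 3) *
     (real ?v ^ ?v * (2 * real ?v) ^ ?v)\<^sup>2"
  \<comment> \<open>Chosen for n < v: then (1 - p) times the minimal weight is at most n^v p^e \<le>
    v^v, so C2 divided by its root is at least 1 and the trivial bound suffices.\<close>
  define C2 where "C2 = sqrt (real ?v ^ ?v)"
  have C1: "0 \<le> C1" by (simp add: C1_def)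
  have C2: "0 < C2" using card_verts_pos by (simp add: C2_def)
  have "kolmogorov_dist (normalized_count_distr G n p) std_normal_distribution
      \<le> (C1 + C2) / sqrt ((1 - p) * min_subgraph_weight G n p)"
    if n: "1 \<le> n" and p: "0 < p" "p < 1" for n p
  proof -
    let ?s = "sqrt ((1 - p) * min_subgraph_weight G n p)"
    have s: "0 < ?s" using min_subgraph_weight_pos[OF n p(1)] p by simp
    show ?thesis
    proof (cases "?v \<le> n")
      case True
      have "kolmogorov_dist (normalized_count_distr G n p) std_normal_distribution \<le> C1 / ?s"
        using kolmogorov_dist_le_large_n[OF True p] by (simp only: C1_def)
      also have "\<dots> \<le> (C1 + C2) / ?s"
        using C2 s by (intro divide_right_mono) auto
      finally show ?thesis .
    next
      case False
      have "(1 - p) * min_subgraph_weight G n p \<le> 1 * (real n ^ ?v * p ^ ?e)"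
        using min_subgraph_weight_le[OF subgraph_refl, of n p] card_edges_pos min_subgraph_weight_pos[OF n p(1)] p
        by (intro mult_mono) auto
      also have "\<dots> \<le> 1 * (real ?v ^ ?v * 1)"
        using False p by (intro mult_left_mono mult_mono power_mono power_le_one) auto
      finally have "?s \<le> C2" by (simp add: C2_def)
      hence "1 \<le> (C1 + C2) / ?s" using C1 s by simp
      thus ?thesis using kolmogorov_dist_le_1[of n p] by linarith
    qed
  qed
  thus ?thesis using C1 C2 by (intro exI[of _ "C1 + C2"]) simp
qed

text \<open>A subgraph with an edge has at least two vertices and at most as many edges as G, so a
  single edge is minimal up to a constant.\<close>

lemma min_subgraph_weight_ge:
  assumes n: "1 \<le> n" and c: "0 < c" "c \<le> p" "p < 1"
  shows "c ^ card (edges G) * (real n)\<^sup>2 \<le> min_subgraph_weight G n p"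
proof -
  obtain H where H: "subgraph H G" "card (edges H) \<ge> 1"
    "min_subgraph_weight G n p = real n ^ card (verts H) * p ^ card (edges H)"
    by (rule min_subgraph_weight_attained)
  have "edges H \<noteq> {}" using H(2) by auto
  then obtain e where e: "e \<in> edges H" by blast
  hence e2: "card e = 2" "e \<subseteq> verts H" "finite (verts H)"
    using H(1) by (auto simp: subgraph_def simple_graph_def)
  have "2 \<le> card (verts H)" using card_mono[OF e2(3,2)] e2(1) by simp
  moreover have "card (edges H) \<le> card (edges G)"
    using H(1) by (intro card_mono finite_edges_G) (simp add: subgraph_def)
  moreover have "c ^ card (edges G) \<le> c ^ card (edges H)"
    using c calculation(2) by (intro power_decreasing) auto
  moreover have "c ^ card (edges H) \<le> p ^ card (edges H)"
    using c by (intro power_mono) auto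
  ultimately have "2 \<le> card (verts H)" "c ^ card (edges G) \<le> p ^ card (edges H)"
    by linarith+
  hence "c ^ card (edges G) * (real n)\<^sup>2 \<le> p ^ card (edges H) * real n ^ card (verts H)"
    using n c by (intro mult_mono power_increasing) auto
  thus ?thesis using H(3) by (simp add: mult.commute)
qed

end

theorem corollary4p3:
  fixes G :: "'a ugraph"
  assumes "simple_graph G" and "verts G \<noteq> {}" and "no_isolated_vertices G"
  shows "(\<forall>c::real. c < 1 \<longrightarrow>
           (\<exists>C>0. \<forall>p :: nat \<Rightarrow> real. (\<forall>n\<ge>1. 0 < p n \<and> p n < 1) \<longrightarrow> (\<forall>n\<ge>1. p n < c) \<longrightarrow>
              (\<forall>n\<ge>1. kolmogorov_dist (normalized_count_distr G n (p n)) std_normal_distribution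
                        \<le> C * min_subgraph_weight G n (p n) powr (- 1 / 2)))) \<and>
         (\<forall>c::real. 0 < c \<longrightarrow>
           (\<exists>C>0. \<forall>p :: nat \<Rightarrow> real. (\<forall>n\<ge>1. 0 < p n \<and> p n < 1) \<longrightarrow> (\<forall>n\<ge>1. p n > c) \<longrightarrow>
              (\<forall>n\<ge>1. kolmogorov_dist (normalized_count_distr G n (p n)) std_normal_distribution
                        \<le> C * (1 / (real n * sqrt (1 - p n))))))"
proof -
  interpret pattern_graph G using assms by unfold_locales
  obtain C where C: "C > 0" and bound: "\<And>n p. 1 \<le> n \<Longrightarrow> 0 < p \<Longrightarrow> p < 1 \<Longrightarrow>
    kolmogorov_dist (normalized_count_distr G n p) std_normal_distribution
      \<le> C / sqrt ((1 - p) * min_subgraph_weight G n p)"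
    using kolmogorov_dist_le by blast
  \<comment> \<open>For p < c the factor 1 - p is bounded below and the minimal weight is kept; for
    p > c the roles are exchanged. Both constants depend only on G and c and are fixed before the
    sequence p.\<close>
  have "kolmogorov_dist (normalized_count_distr G n p) std_normal_distribution
      \<le> (C / sqrt (1 - c)) * min_subgraph_weight G n p powr (- 1 / 2)"
    if "c < 1" "1 \<le> n" "0 < p" "p < 1" "p < c" for c p and n :: nat
  proof -
    have Psi: "0 < min_subgraph_weight G n p" using that by (intro min_subgraph_weight_pos)
    have "C / sqrt ((1 - p) * min_subgraph_weight G n p) \<le> C / sqrt ((1 - c) * min_subgraph_weight G n p)"
      using that C Psi by (intro divide_left_mono real_sqrt_le_mono mult_right_mono mult_pos_pos) auto
    also have "\<dots> = (C / sqrt (1 - c)) * min_subgraph_weight G n p powr (- 1 / 2)"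
      using Psi by (simp add: real_sqrt_mult powr_minus_divide powr_half_sqrt)
    finally show ?thesis using bound[of n p] that by linarith
  qed
  moreover have "kolmogorov_dist (normalized_count_distr G n p) std_normal_distribution
      \<le> (C / sqrt (c ^ card (edges G))) * (1 / (real n * sqrt (1 - p)))"
    if "0 < c" "1 \<le> n" "0 < p" "p < 1" "c < p" for c p and n :: nat
  proof -
    have "c ^ card (edges G) * (real n)\<^sup>2 \<le> min_subgraph_weight G n p"
      using that by (intro min_subgraph_weight_ge) auto
    moreover have "0 < min_subgraph_weight G n p" using that by (intro min_subgraph_weight_pos)
    ultimately have "C / sqrt ((1 - p) * min_subgraph_weight G n p) \<le> C / sqrt ((1 - p) * (c ^ card (edges G) * (real n)\<^sup>2))"
      using that C by (intro divide_left_mono real_sqrt_le_mono mult_left_mono mult_pos_pos) auto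
    also have "\<dots> = (C / sqrt (c ^ card (edges G))) * (1 / (real n * sqrt (1 - p)))"
      by (simp add: real_sqrt_mult mult_ac)
    finally show ?thesis using bound[of n p] that by linarith
  qed
  moreover have "0 < C / sqrt (1 - c)" if "c < 1" for c using C that by simp
  moreover have "0 < C / sqrt (c ^ card (edges G))" if "0 < c" for c using C that by simp
  ultimately show ?thesis by meson
qed

end
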